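(* Let $R(A,P_0)$ be a trinomial algebra of type 1. (a) Let $\delta=\frac{\partial}{\partial S_p}$ for some $1\le p\le m$. Then an element $h\in R(A,P_0)$ is a $K_0$-homogeneous element of $\ker\delta$ if and only if $$h=F(T_1^{l_1})\prod_{i,j}T_{ij}^{b_{ij}}\prod_{k\ne p}S_k^{d_k}$$ for some $b_{ij},d_k\in\mathbb Z_{\ge0}$ and some polynomial $F$ in one variable over $\mathbb K$. (b) Let $\delta=\delta_C$ (for a tuple $C$ for which $\delta_C$ is defined). Then $h\in R(A,P_0)$ is a $K_0$-homogeneous element of $\ker\delta$ if and only if $$h=\alpha\prod_{T_{ij}\in\ker\delta}T_{ij}^{b_{ij}}\prod_k S_k^{d_k}$$ for some $b_{ij},d_k\in\mathbb Z_{\ge0}$ and $\alpha\in\mathbb K$.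
   Context: Ground field: $\mathbb K$ is an algebraically closed field of characteristic zero. Trinomial algebras of type 1: fix integers $r,n>0$, $m\ge 0$, a partition $n=n_1+\dots+n_r$ with $n_i>0$, and for each $i=1,\dots,r$ a tuple of positive integers $l_i=(l_{i1},\dots,l_{in_i})$. Put $T_i^{l_i}=T_{i1}^{l_{i1}}\cdots T_{in_i}^{l_{in_i}}$ in the polynomial ring $\mathbb K[T_{ij},S_k]$ ($1\le i\le r$, $1\le j\le n_i$, $1\le k\le m$). Let $A=(a_1,\dots,a_r)\in\mathbb K^r$ have pairwise different entries, and put $\mathfrak g_i=T_i^{l_i}-T_{i+1}^{l_{i+1}}-(a_{i+1}-a_i)$ for $i=1,\dots,r-1$. Let $P_0$ be the integer $r\times(n+m)$ matrix (columns indexed by the variables $T_{ij}$, then $S_k$) whose $i$-th row has $l_i$ in the block of columns $T_{i1},\dots,T_{in_i}$ and $0$ elsewhere. The trinomial algebra is $R(A,P_0)=\mathbb K[T_{ij},S_k]/(\mathfrak g_1,\dots,\mathfrak g_{r-1})$. Let $K_0=\mathbb Z^{n+m}/\mathrm{im}(P_0^T)$ with quotient map $Q$, and let $v_{ij},v_k$ be the standard basis vectors of $\mathbb Z^{n+m}$. The $K_0$-grading of $R(A,P_0)$ is induced by $\deg T_{ij}=Q(v_{ij})$, $\deg S_k=Q(v_k)$. Derivations ($\mathbb K$-linear maps satisfying the Leibniz rule), given on generators and well defined on $R(A,P_0)$ (empty products equal 1): For $1\le p\le m$: $\frac{\partial}{\partial S_p}(T_{ij})=0$ for all $(i,j)$;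 $\frac{\partial}{\partial S_p}(S_k)=1$ if $k=p$ and $0$ if $k\ne p$. For a tuple $C=(c_1,\dots,c_r)$ with $1\le c_i\le n_i$ and $l_{ic_i}=1$ for all $i$ except at most one: $\delta_C(T_{ic_i})=\prod_{k\ne i}\frac{\partial T_k^{l_k}}{\partial T_{kc_k}}$, $\delta_C(T_{ij})=0$ for $j\neq c_i$, $\delta_C(S_k)=0$ for all $k$. These derivations are locally nilpotent. The product over $T_{ij}\in\ker\delta$ runs over those pairs $(i,j)$ with $\delta(T_{ij})=0$. *)

theory Defs
  imports
    "HOL-Algebra.Algebra"
    "HOL-Library.Poly_Mapping"
    "HOL-Computational_Algebra.Polynomial"
begin

section \<open>Multivariate polynomials\<close>

text \<open>Polynomials are finitely supported maps from exponent vectors to coefficients;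
  \<open>Tvar i j\<close> and \<open>Svar k\<close> stand for the variables \<open>T\<^sub>i\<^sub>j\<close> and \<open>S\<^sub>k\<close>, all indices
  starting at \<open>1\<close>.\<close>

datatype tvar = Tvar nat nat | Svar nat

type_synonym 'k mpol = "(tvar \<Rightarrow>\<^sub>0 nat) \<Rightarrow>\<^sub>0 'k"

definition Const :: "'k::comm_ring_1 \<Rightarrow> 'k mpol" where
  "Const c = Poly_Mapping.single 0 c"

definition Var :: "tvar \<Rightarrow> 'k::comm_ring_1 mpol" where
  "Var v = Poly_Mapping.single (Poly_Mapping.single v 1) 1"

definition partial_deriv :: "tvar \<Rightarrow> 'k::comm_ring_1 mpol \<Rightarrow> 'k mpol" where
  "partial_deriv v f =
     (\<Sum>u\<in>Poly_Mapping.keys f. Poly_Mapping.single (u - Poly_Mapping.single v 1)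
        (of_nat (Poly_Mapping.lookup u v) * Poly_Mapping.lookup f u))"

definition mpol_ring :: "tvar set \<Rightarrow> 'k::comm_ring_1 mpol ring" where
  "mpol_ring V = \<lparr> carrier = {f. \<forall>u\<in>Poly_Mapping.keys f. Poly_Mapping.keys u \<subseteq> V},
     monoid.mult = (*), one = 1, ring.zero = 0, add = (+) \<rparr>"


section \<open>Trinomial algebras of type 1\<close>

text \<open>Throughout, \<open>r\<close> is the number of blocks, \<open>m\<close> the number of variables \<open>S\<^sub>k\<close>, \<open>ns i\<close> the
  size \<open>n\<^sub>i\<close> of the \<open>i\<close>-th block, \<open>l i j\<close> the exponent \<open>l\<^sub>i\<^sub>j\<close> and \<open>a i\<close> the entry \<open>a\<^sub>i\<close> of \<open>A\<close>.\<close>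

definition tvars :: "nat \<Rightarrow> nat \<Rightarrow> (nat \<Rightarrow> nat) \<Rightarrow> tvar set" where
  "tvars r m ns = {Tvar i j |i j. i \<in> {1..r} \<and> j \<in> {1..ns i}} \<union> {Svar k |k. k \<in> {1..m}}"

definition T_mono :: "(nat \<Rightarrow> nat) \<Rightarrow> (nat \<Rightarrow> nat \<Rightarrow> nat) \<Rightarrow> nat \<Rightarrow> 'k::comm_ring_1 mpol" where
  "T_mono ns l i = (\<Prod>j=1..ns i. Var (Tvar i j) ^ l i j)"

definition trinomial ::
  "(nat \<Rightarrow> nat) \<Rightarrow> (nat \<Rightarrow> nat \<Rightarrow> nat) \<Rightarrow> (nat \<Rightarrow> 'k) \<Rightarrow> nat \<Rightarrow> 'k::comm_ring_1 mpol" where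
  "trinomial ns l a i = T_mono ns l i - T_mono ns l (i + 1) - Const (a (i + 1) - a i)"

definition trinomial_ideal ::
  "nat \<Rightarrow> nat \<Rightarrow> (nat \<Rightarrow> nat) \<Rightarrow> (nat \<Rightarrow> nat \<Rightarrow> nat) \<Rightarrow> (nat \<Rightarrow> 'k) \<Rightarrow> 'k::comm_ring_1 mpol set" where
  "trinomial_ideal r m ns l a =
     genideal (mpol_ring (tvars r m ns)) (trinomial ns l a ` {1..<r})"

definition trinomial_algebra ::
  "nat \<Rightarrow> nat \<Rightarrow> (nat \<Rightarrow> nat) \<Rightarrow> (nat \<Rightarrow> nat \<Rightarrow> nat) \<Rightarrow> (nat \<Rightarrow> 'k)
     \<Rightarrow> 'k::comm_ring_1 mpol set ring" where
  "trinomial_algebra r m ns l a =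
     mpol_ring (tvars r m ns) Quot trinomial_ideal r m ns l a"

definition residue_cl ::
  "nat \<Rightarrow> nat \<Rightarrow> (nat \<Rightarrow> nat) \<Rightarrow> (nat \<Rightarrow> nat \<Rightarrow> nat) \<Rightarrow> (nat \<Rightarrow> 'k)
     \<Rightarrow> 'k::comm_ring_1 mpol \<Rightarrow> 'k mpol set" where
  "residue_cl r m ns l a f = trinomial_ideal r m ns l a +>\<^bsub>mpol_ring (tvars r m ns)\<^esub> f"


section \<open>The grading by \<open>K\<^sub>0\<close>\<close>

text \<open>\<open>\<int>\<^sup>n\<^sup>+\<^sup>m\<close> is the free abelian group on the variables, \<open>frag_of v\<close> being the
  standard basis vector belonging to the variable \<open>v\<close>.\<close>

definition P0 :: "(nat \<Rightarrow> nat \<Rightarrow> nat) \<Rightarrow> nat \<Rightarrow> tvar \<Rightarrow> int" where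
  "P0 l i v = (case v of Tvar i' j \<Rightarrow> if i' = i then int (l i j) else 0 | Svar k \<Rightarrow> 0)"

definition im_P0T :: "nat \<Rightarrow> nat \<Rightarrow> (nat \<Rightarrow> nat) \<Rightarrow> (nat \<Rightarrow> nat \<Rightarrow> nat) \<Rightarrow> (tvar \<Rightarrow>\<^sub>0 int) set" where
  "im_P0T r m ns l =
     range (\<lambda>y :: nat \<Rightarrow> int. \<Sum>v\<in>tvars r m ns. frag_cmul (\<Sum>i=1..r. P0 l i v * y i) (frag_of v))"

definition K0 ::
  "nat \<Rightarrow> nat \<Rightarrow> (nat \<Rightarrow> nat) \<Rightarrow> (nat \<Rightarrow> nat \<Rightarrow> nat) \<Rightarrow> (tvar \<Rightarrow>\<^sub>0 int) set monoid" where
  "K0 r m ns l = free_Abelian_group (tvars r m ns) Mod im_P0T r m ns l"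

definition Q ::
  "nat \<Rightarrow> nat \<Rightarrow> (nat \<Rightarrow> nat) \<Rightarrow> (nat \<Rightarrow> nat \<Rightarrow> nat) \<Rightarrow> (tvar \<Rightarrow>\<^sub>0 int) \<Rightarrow> (tvar \<Rightarrow>\<^sub>0 int) set" where
  "Q r m ns l x = im_P0T r m ns l #>\<^bsub>free_Abelian_group (tvars r m ns)\<^esub> x"

text \<open>The degree of the monomial with exponent vector \<open>u\<close>; as \<open>Q\<close> is a homomorphism this is
  the multiplicative extension of \<open>v \<mapsto> Q (frag_of v)\<close>.\<close>

definition monom_deg ::
  "nat \<Rightarrow> nat \<Rightarrow> (nat \<Rightarrow> nat) \<Rightarrow> (nat \<Rightarrow> nat \<Rightarrow> nat) \<Rightarrow> (tvar \<Rightarrow>\<^sub>0 nat) \<Rightarrow> (tvar \<Rightarrow>\<^sub>0 int) set" where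
  "monom_deg r m ns l u =
     Q r m ns l (\<Sum>v\<in>Poly_Mapping.keys u. frag_cmul (int (Poly_Mapping.lookup u v)) (frag_of v))"

definition graded_part ::
  "nat \<Rightarrow> nat \<Rightarrow> (nat \<Rightarrow> nat) \<Rightarrow> (nat \<Rightarrow> nat \<Rightarrow> nat) \<Rightarrow> (nat \<Rightarrow> 'k)
     \<Rightarrow> (tvar \<Rightarrow>\<^sub>0 int) set \<Rightarrow> 'k::comm_ring_1 mpol set set" where
  "graded_part r m ns l a w =
     residue_cl r m ns l a `
       {f \<in> carrier (mpol_ring (tvars r m ns)).
          \<forall>u\<in>Poly_Mapping.keys f. monom_deg r m ns l u = w}"

text \<open>Zero lies in every graded part and hence counts as homogeneous.\<close>

definition K0_homogeneous ::
  "nat \<Rightarrow> nat \<Rightarrow> (nat \<Rightarrow> nat) \<Rightarrow> (nat \<Rightarrow> nat \<Rightarrow> nat) \<Rightarrow> (nat \<Rightarrow> 'k)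
     \<Rightarrow> 'k::comm_ring_1 mpol set \<Rightarrow> bool" where
  "K0_homogeneous r m ns l a h \<longleftrightarrow>
     (\<exists>w\<in>carrier (K0 r m ns l). h \<in> graded_part r m ns l a w)"


section \<open>Derivations\<close>

text \<open>\<open>sc\<close> is the structure map of the algebra \<open>R\<close> over the ground field.\<close>

definition derivation_on ::
  "('k \<Rightarrow> 'r) \<Rightarrow> ('r, 'b) ring_scheme \<Rightarrow> ('r \<Rightarrow> 'r) \<Rightarrow> bool" where
  "derivation_on sc R \<delta> \<longleftrightarrow>
     \<delta> \<in> carrier R \<rightarrow> carrier R \<and>
     (\<forall>x\<in>carrier R. \<forall>y\<in>carrier R. \<delta> (x \<oplus>\<^bsub>R\<^esub> y) = \<delta> x \<oplus>\<^bsub>R\<^esub> \<delta> y) \<and>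
     (\<forall>c. \<forall>x\<in>carrier R. \<delta> (sc c \<otimes>\<^bsub>R\<^esub> x) = sc c \<otimes>\<^bsub>R\<^esub> \<delta> x) \<and>
     (\<forall>x\<in>carrier R. \<forall>y\<in>carrier R.
        \<delta> (x \<otimes>\<^bsub>R\<^esub> y) = (\<delta> x \<otimes>\<^bsub>R\<^esub> y) \<oplus>\<^bsub>R\<^esub> (x \<otimes>\<^bsub>R\<^esub> \<delta> y))"

text \<open>\<open>\<delta>\<close> is the \<open>k\<close>-linear derivation of the trinomial algebra sending the class of each variable
  \<open>v\<close> to the class of \<open>g v\<close>.\<close>

definition derivation_with_values ::
  "nat \<Rightarrow> nat \<Rightarrow> (nat \<Rightarrow> nat) \<Rightarrow> (nat \<Rightarrow> nat \<Rightarrow> nat) \<Rightarrow> (nat \<Rightarrow> 'k)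
     \<Rightarrow> (tvar \<Rightarrow> 'k mpol) \<Rightarrow> ('k::comm_ring_1 mpol set \<Rightarrow> 'k mpol set) \<Rightarrow> bool" where
  "derivation_with_values r m ns l a g \<delta> \<longleftrightarrow>
     derivation_on (\<lambda>c. residue_cl r m ns l a (Const c)) (trinomial_algebra r m ns l a) \<delta> \<and>
     (\<forall>v\<in>tvars r m ns. \<delta> (residue_cl r m ns l a (Var v)) = residue_cl r m ns l a (g v))"

definition is_partial_S ::
  "nat \<Rightarrow> nat \<Rightarrow> (nat \<Rightarrow> nat) \<Rightarrow> (nat \<Rightarrow> nat \<Rightarrow> nat) \<Rightarrow> (nat \<Rightarrow> 'k)
     \<Rightarrow> nat \<Rightarrow> ('k::comm_ring_1 mpol set \<Rightarrow> 'k mpol set) \<Rightarrow> bool" where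
  "is_partial_S r m ns l a p \<delta> \<longleftrightarrow>
     derivation_with_values r m ns l a
       (\<lambda>v. case v of Tvar i j \<Rightarrow> 0 | Svar k \<Rightarrow> if k = p then 1 else 0) \<delta>"

definition admissible_tuple ::
  "nat \<Rightarrow> (nat \<Rightarrow> nat) \<Rightarrow> (nat \<Rightarrow> nat \<Rightarrow> nat) \<Rightarrow> (nat \<Rightarrow> nat) \<Rightarrow> bool" where
  "admissible_tuple r ns l C \<longleftrightarrow>
     (\<forall>i\<in>{1..r}. C i \<in> {1..ns i}) \<and> card {i\<in>{1..r}. l i (C i) \<noteq> 1} \<le> 1"

definition is_delta ::
  "nat \<Rightarrow> nat \<Rightarrow> (nat \<Rightarrow> nat) \<Rightarrow> (nat \<Rightarrow> nat \<Rightarrow> nat) \<Rightarrow> (nat \<Rightarrow> 'k)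
     \<Rightarrow> (nat \<Rightarrow> nat) \<Rightarrow> ('k::comm_ring_1 mpol set \<Rightarrow> 'k mpol set) \<Rightarrow> bool" where
  "is_delta r m ns l a C \<delta> \<longleftrightarrow>
     derivation_with_values r m ns l a
       (\<lambda>v. case v of
              Tvar i j \<Rightarrow> if j = C i
                then (\<Prod>k\<in>{1..r} - {i}. partial_deriv (Tvar k (C k)) (T_mono ns l k)) else 0
            | Svar k \<Rightarrow> 0) \<delta>"


section \<open>Existence of the derivations\<close>

text \<open>The predicates \<open>is_partial_S\<close> and \<open>is_delta\<close> are satisfiable: the vector field with
  components \<open>g v\<close> on the polynomial ring annihilates the generators of the ideal and so descends
  to the quotient.\<close>

definition deriv_monom :: "tvar \<Rightarrow> (tvar \<Rightarrow>\<^sub>0 nat) \<Rightarrow> 'k \<Rightarrow> 'k::comm_ring_1 mpol" where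
  "deriv_monom v u c = Poly_Mapping.single (u - Poly_Mapping.single v 1)
        (of_nat (Poly_Mapping.lookup u v) * c)"

lemma partial_deriv_superset:
  assumes "finite A" "Poly_Mapping.keys f \<subseteq> A"
  shows "partial_deriv v f = (\<Sum>u\<in>A. deriv_monom v u (Poly_Mapping.lookup f u))"
  unfolding partial_deriv_def deriv_monom_def
  using assms by (intro sum.mono_neutral_left) (auto simp: in_keys_iff)

lemma partial_deriv_add: "partial_deriv v (f + g) = partial_deriv v f + partial_deriv v g"
proof -
  let ?A = "Poly_Mapping.keys f \<union> Poly_Mapping.keys g"
  have "partial_deriv v (f + g) = (\<Sum>u\<in>?A. deriv_monom v u (Poly_Mapping.lookup (f + g) u))"
    by (intro partial_deriv_superset keys_add) auto
  also have "\<dots> = (\<Sum>u\<in>?A. deriv_monom v u (Poly_Mapping.lookup f u))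
      + (\<Sum>u\<in>?A. deriv_monom v u (Poly_Mapping.lookup g u))"
    by (simp add: deriv_monom_def lookup_add algebra_simps single_add sum.distrib)
  also have "\<dots> = partial_deriv v f + partial_deriv v g"
    by (subst (1 2) partial_deriv_superset[of ?A]) auto
  finally show ?thesis .
qed

lemma partial_deriv_0 [simp]: "partial_deriv v 0 = 0"
  by (simp add: partial_deriv_def)

lemma partial_deriv_sum: "partial_deriv v (sum f A) = (\<Sum>x\<in>A. partial_deriv v (f x))"
  by (induction A rule: infinite_finite_induct) (auto simp: partial_deriv_add)

lemma partial_deriv_single:
  "partial_deriv v (Poly_Mapping.single u c) = deriv_monom v u c"
  by (cases "c = 0") (auto simp: partial_deriv_def deriv_monom_def)

lemma mpol_expand:
  "f = (\<Sum>u\<in>Poly_Mapping.keys f. Poly_Mapping.single u (Poly_Mapping.lookup f u))"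
proof (rule poly_mapping_eqI)
  fix k
  have "(\<Sum>u\<in>Poly_Mapping.keys f. Poly_Mapping.lookup f u when u = k) = Poly_Mapping.lookup f k"
    by (cases "k \<in> Poly_Mapping.keys f") (auto simp: when_def in_keys_iff)
  then show "Poly_Mapping.lookup f k = Poly_Mapping.lookup
      (\<Sum>u\<in>Poly_Mapping.keys f. Poly_Mapping.single u (Poly_Mapping.lookup f u)) k"
    by (simp add: lookup_sum lookup_single)
qed

lemma deriv_monom_mult:
  "deriv_monom v (u + w) (c * d) =
     deriv_monom v u c * Poly_Mapping.single w d + Poly_Mapping.single u c * deriv_monom v w d"
proof -
  have *: "Poly_Mapping.lookup x v \<noteq> 0 \<Longrightarrow>
      x + y - Poly_Mapping.single v 1 = (x - Poly_Mapping.single v 1) + y"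
    for x y :: "tvar \<Rightarrow>\<^sub>0 nat"
    by (rule poly_mapping_eqI) (auto simp: lookup_add lookup_minus lookup_single when_def)
  have 1: "deriv_monom v u c * Poly_Mapping.single w d =
      Poly_Mapping.single (u + w - Poly_Mapping.single v 1)
        (of_nat (Poly_Mapping.lookup u v) * (c * d))"
    by (cases "Poly_Mapping.lookup u v = 0")
       (simp_all add: deriv_monom_def mult_single mult.assoc * [simplified One_nat_def])
  have 2: "Poly_Mapping.single u c * deriv_monom v w d =
      Poly_Mapping.single (u + w - Poly_Mapping.single v 1)
        (of_nat (Poly_Mapping.lookup w v) * (c * d))"
    by (cases "Poly_Mapping.lookup w v = 0")
       (simp_all add: deriv_monom_def mult_single add.commute[of u] mult_ac * [simplified One_nat_def])
  show ?thesis
    unfolding 1 2 by (simp add: deriv_monom_def lookup_add algebra_simps flip: single_add)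
qed

lemma partial_deriv_mult:
  "partial_deriv v (f * g) = partial_deriv v f * g + f * partial_deriv v g"
proof -
  let ?F = "\<lambda>f u. Poly_Mapping.single u (Poly_Mapping.lookup f u)"
  let ?A = "Poly_Mapping.keys f" and ?B = "Poly_Mapping.keys g"
  have f: "f = sum (?F f) ?A" and g: "g = sum (?F g) ?B" by (rule mpol_expand)+
  have pf: "partial_deriv v f = (\<Sum>x\<in>?A. partial_deriv v (?F f x))"
    by (subst f) (rule partial_deriv_sum)
  have pg: "partial_deriv v g = (\<Sum>x\<in>?B. partial_deriv v (?F g x))"
    by (subst g) (rule partial_deriv_sum)
  have "f * g = (\<Sum>x\<in>?A. \<Sum>y\<in>?B. ?F f x * ?F g y)"
    by (subst f, subst g) (rule sum_product)
  then have "partial_deriv v (f * g) = (\<Sum>x\<in>?A. \<Sum>y\<in>?B. partial_deriv v (?F f x * ?F g y))"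
    by (simp add: partial_deriv_sum)
  also have "\<dots> = (\<Sum>x\<in>?A. \<Sum>y\<in>?B. partial_deriv v (?F f x) * ?F g y)
      + (\<Sum>x\<in>?A. \<Sum>y\<in>?B. ?F f x * partial_deriv v (?F g y))"
    by (simp add: mult_single partial_deriv_single deriv_monom_mult sum.distrib)
  also have "\<dots> = partial_deriv v f * sum (?F g) ?B + sum (?F f) ?A * partial_deriv v g"
    by (simp only: pf pg sum_product)
  finally show ?thesis using f g by simp
qed

lemma partial_deriv_Const [simp]: "partial_deriv v (Const c) = 0"
  by (simp add: Const_def partial_deriv_single deriv_monom_def)

lemma Const_1: "Const 1 = 1" by (simp add: Const_def)

lemma partial_deriv_1 [simp]: "partial_deriv v 1 = 0"
  using partial_deriv_Const[of v 1] by (simp only: Const_1)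

lemma partial_deriv_Var: "partial_deriv v (Var w) = (if w = v then 1 else 0)"
  by (auto simp: Var_def partial_deriv_single deriv_monom_def lookup_single when_def)

definition jac :: "tvar set \<Rightarrow> (tvar \<Rightarrow> 'k mpol) \<Rightarrow> 'k::comm_ring_1 mpol \<Rightarrow> 'k mpol" where
  "jac V g f = (\<Sum>v\<in>V. g v * partial_deriv v f)"

lemma jac_add: "jac V g (f + f') = jac V g f + jac V g f'"
  by (simp add: jac_def partial_deriv_add algebra_simps sum.distrib)

lemma jac_mult: "jac V g (f * f') = jac V g f * f' + f * jac V g f'"
  by (simp add: jac_def partial_deriv_mult algebra_simps sum.distrib sum_distrib_left sum_distrib_right)

lemma jac_Const [simp]: "jac V g (Const c) = 0" by (simp add: jac_def)

lemma jac_0 [simp]: "jac V g 0 = 0" by (simp add: jac_def)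

lemma jac_uminus: "jac V g (- f) = - jac V g f"
  using jac_add[of V g f "-f"] by (simp add: minus_unique)

lemma jac_diff: "jac V g (f - f') = jac V g f - jac V g f'"
  using jac_add[of V g f "-f'"] by (simp add: jac_uminus)

lemma jac_Var: "finite V \<Longrightarrow> v \<in> V \<Longrightarrow> jac V g (Var v) = g v"
  by (simp add: jac_def partial_deriv_Var if_distrib[of "(*) _"] cong: if_cong)

lemma finite_tvars: "finite (tvars r m ns)"
proof -
  have "tvars r m ns = (\<lambda>(i,j). Tvar i j) ` (SIGMA i:{1..r}. {1..ns i}) \<union> Svar ` {1..m}"
    by (auto simp: tvars_def image_iff)
  then show ?thesis by simp
qed

lemma mpol_ring_carrier:
  "f \<in> carrier (mpol_ring V) \<longleftrightarrow> (\<forall>u\<in>Poly_Mapping.keys f. Poly_Mapping.keys u \<subseteq> V)"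
  by (simp add: mpol_ring_def)

lemma mpol_ring_sel [simp]:
  "monoid.mult (mpol_ring V) = (*)" "one (mpol_ring V) = 1"
  "ring.zero (mpol_ring V) = 0" "add (mpol_ring V) = (+)"
  by (simp_all add: mpol_ring_def)

lemma mpol_carrier_add: "f \<in> carrier (mpol_ring V) \<Longrightarrow> g \<in> carrier (mpol_ring V) \<Longrightarrow>
    f + g \<in> carrier (mpol_ring V)"
  using keys_add[of f g] by (auto simp: mpol_ring_carrier)

lemma mpol_carrier_uminus: "f \<in> carrier (mpol_ring V) \<Longrightarrow> - f \<in> carrier (mpol_ring V)"
  by (auto simp: mpol_ring_carrier in_keys_iff)

lemma mpol_carrier_diff: "f \<in> carrier (mpol_ring V) \<Longrightarrow> g \<in> carrier (mpol_ring V) \<Longrightarrow>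
    f - g \<in> carrier (mpol_ring V)"
  using mpol_carrier_add[of f V "-g"] mpol_carrier_uminus[of g V] by simp

lemma mpol_carrier_mult: assumes "f \<in> carrier (mpol_ring V)" "g \<in> carrier (mpol_ring V)"
  shows "f * g \<in> carrier (mpol_ring V)"
proof -
  have "Poly_Mapping.keys u \<subseteq> V" if u: "u \<in> Poly_Mapping.keys (f * g)" for u
  proof -
    obtain x y where "u = x + y" "x \<in> Poly_Mapping.keys f" "y \<in> Poly_Mapping.keys g"
      using keys_mult[of f g] u by blast
    then show ?thesis using assms keys_add[of x y] by (fastforce simp: mpol_ring_carrier)
  qed
  then show ?thesis by (simp add: mpol_ring_carrier)
qed

lemma mpol_carrier_Const [simp]: "Const c \<in> carrier (mpol_ring V)"
  by (auto simp: mpol_ring_carrier Const_def)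

lemma mpol_carrier_0 [simp]: "0 \<in> carrier (mpol_ring V)"
  by (auto simp: mpol_ring_carrier)

lemma mpol_carrier_1 [simp]: "1 \<in> carrier (mpol_ring V)"
  by (auto simp: mpol_ring_carrier)

lemma mpol_carrier_Var: "v \<in> V \<Longrightarrow> Var v \<in> carrier (mpol_ring V)"
  by (auto simp: mpol_ring_carrier Var_def)

lemma mpol_carrier_sum: "(\<And>x. x \<in> A \<Longrightarrow> f x \<in> carrier (mpol_ring V)) \<Longrightarrow> sum f A \<in> carrier (mpol_ring V)"
  by (induction A rule: infinite_finite_induct) (auto simp: mpol_carrier_add)

lemma mpol_carrier_prod: "(\<And>x. x \<in> A \<Longrightarrow> f x \<in> carrier (mpol_ring V)) \<Longrightarrow> prod f A \<in> carrier (mpol_ring V)"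
  by (induction A rule: infinite_finite_induct) (auto simp: mpol_carrier_mult)

lemma mpol_carrier_power: "f \<in> carrier (mpol_ring V) \<Longrightarrow> f ^ n \<in> carrier (mpol_ring V)"
  by (induction n) (auto simp: mpol_carrier_mult)

lemma mpol_carrier_partial_deriv:
  assumes "f \<in> carrier (mpol_ring V)" shows "partial_deriv v f \<in> carrier (mpol_ring V)"
  unfolding partial_deriv_def
proof (rule mpol_carrier_sum)
  fix u assume u: "u \<in> Poly_Mapping.keys f"
  have "Poly_Mapping.keys (u - Poly_Mapping.single v 1) \<subseteq> Poly_Mapping.keys u"
    by (auto simp: in_keys_iff lookup_minus)
  then show "Poly_Mapping.single (u - Poly_Mapping.single v 1)
      (of_nat (Poly_Mapping.lookup u v) * Poly_Mapping.lookup f u) \<in> carrier (mpol_ring V)"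
    using assms u by (auto simp: mpol_ring_carrier)
qed

lemma mpol_carrier_T_mono: "i \<in> {1..r} \<Longrightarrow> T_mono ns l i \<in> carrier (mpol_ring (tvars r m ns))"
  unfolding T_mono_def by (intro mpol_carrier_prod mpol_carrier_power mpol_carrier_Var) (auto simp: tvars_def)

lemma mpol_carrier_trinomial:
  "i \<in> {1..<r} \<Longrightarrow> trinomial ns l a i \<in> carrier (mpol_ring (tvars r m ns))"
  unfolding trinomial_def by (intro mpol_carrier_diff mpol_carrier_T_mono mpol_carrier_Const) auto

lemma mpol_carrier_jac:
  "\<lbrakk>f \<in> carrier (mpol_ring V); \<And>v. v \<in> V \<Longrightarrow> g v \<in> carrier (mpol_ring V)\<rbrakk>
     \<Longrightarrow> jac V g f \<in> carrier (mpol_ring V)"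
  unfolding jac_def by (intro mpol_carrier_sum mpol_carrier_mult mpol_carrier_partial_deriv) auto

lemma mpol_ring_cring: "cring (mpol_ring V :: 'k::comm_ring_1 mpol ring)"
proof (rule cringI)
  show "abelian_group (mpol_ring V :: 'k mpol ring)"
    by (rule abelian_groupI)
       (auto simp: mpol_carrier_add algebra_simps intro!: bexI[of _ "- x" for x] mpol_carrier_uminus)
  show "comm_monoid (mpol_ring V :: 'k mpol ring)"
    by (rule comm_monoidI) (auto simp: mpol_carrier_mult algebra_simps)
qed (auto simp: algebra_simps)

lemma ideal_trinomial_ideal: 
  "ideal (trinomial_ideal r m ns l a) (mpol_ring (tvars r m ns))"
proof -
  interpret cring "mpol_ring (tvars r m ns)" by (rule mpol_ring_cring)
  show ?thesis unfolding trinomial_ideal_def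
    by (intro genideal_ideal) (use mpol_carrier_trinomial in blast)
qed

lemma Const_minus_1_mult: "Const (- 1) * x = - x"
proof -
  have "Const (- 1) = (- 1 :: 'a mpol)" by (simp add: Const_def single_uminus)
  then show ?thesis by simp
qed

lemma jac_trinomial_ideal:
  fixes a :: "nat \<Rightarrow> 'k::comm_ring_1"
  assumes g: "\<And>v. v \<in> tvars r m ns \<Longrightarrow> g v \<in> carrier (mpol_ring (tvars r m ns))"
    and 0: "\<And>i. i \<in> {1..<r} \<Longrightarrow> jac (tvars r m ns) g (trinomial ns l a i) = 0"
    and f: "f \<in> trinomial_ideal r m ns l a"
  shows "jac (tvars r m ns) g f \<in> trinomial_ideal r m ns l a"
proof -
  let ?V = "tvars r m ns"
  let ?I = "trinomial_ideal r m ns l a"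
  interpret P: cring "mpol_ring ?V :: 'k mpol ring" by (rule mpol_ring_cring)
  interpret I: ideal ?I "mpol_ring ?V" by (rule ideal_trinomial_ideal)
  have neg: "- x \<in> ?I" if "x \<in> ?I" for x
    using I.I_l_closed[OF that, of "Const (-1)"]
    by (simp add: Const_minus_1_mult)
  have "ideal {f \<in> ?I. jac ?V g f \<in> ?I} (mpol_ring ?V)"
  proof (rule idealI)
    show "ring (mpol_ring ?V :: 'k mpol ring)" by unfold_locales
    show "subgroup {f \<in> ?I. jac ?V g f \<in> ?I} (add_monoid (mpol_ring ?V))"
    proof (rule group.subgroupI)
      show "Group.group (add_monoid (mpol_ring ?V :: 'k mpol ring))" by (rule P.a_group)
      show "{f \<in> ?I. jac ?V g f \<in> ?I} \<subseteq> carrier (add_monoid (mpol_ring ?V))"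
        using I.a_Hcarr by auto
      show "{f \<in> ?I. jac ?V g f \<in> ?I} \<noteq> {}"
        using I.zero_closed by (auto intro!: exI[of _ 0])
    next
      fix x assume x: "x \<in> {f \<in> ?I. jac ?V g f \<in> ?I}"
      then have "x \<in> carrier (mpol_ring ?V)" using I.a_Hcarr by auto
      then have "\<ominus>\<^bsub>mpol_ring ?V\<^esub> x = - x"
        by (intro P.minus_equality) (auto simp: mpol_carrier_uminus)
      then show "inv\<^bsub>add_monoid (mpol_ring ?V)\<^esub> x \<in> {f \<in> ?I. jac ?V g f \<in> ?I}"
        using x neg by (simp add: a_inv_def jac_uminus)
    next
      fix x y assume "x \<in> {f \<in> ?I. jac ?V g f \<in> ?I}" "y \<in> {f \<in> ?I. jac ?V g f \<in> ?I}"
      then show "x \<otimes>\<^bsub>add_monoid (mpol_ring ?V)\<^esub> y \<in> {f \<in> ?I. jac ?V g f \<in> ?I}"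
        using I.a_closed by (auto simp: jac_add)
    qed
  next
    fix x y :: "'k mpol" assume x: "x \<in> {f \<in> ?I. jac ?V g f \<in> ?I}" and y: "y \<in> carrier (mpol_ring ?V)"
    have "y * x \<in> ?I" "jac ?V g y * x \<in> ?I" "y * jac ?V g x \<in> ?I"
      using x y I.I_l_closed mpol_carrier_jac[OF y g] by auto
    then have *: "y * x \<in> {f \<in> ?I. jac ?V g f \<in> ?I}"
      using I.a_closed by (auto simp: jac_mult)
    show "y \<otimes>\<^bsub>mpol_ring ?V\<^esub> x \<in> {f \<in> ?I. jac ?V g f \<in> ?I}" using * by simp
    show "x \<otimes>\<^bsub>mpol_ring ?V\<^esub> y \<in> {f \<in> ?I. jac ?V g f \<in> ?I}" using * by (simp add: mult.commute)
  qed
  moreover have "trinomial ns l a ` {1..<r} \<subseteq> {f \<in> ?I. jac ?V g f \<in> ?I}"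
  proof -
    have "trinomial ns l a ` {1..<r} \<subseteq> ?I"
      unfolding trinomial_ideal_def
      by (rule P.genideal_self) (use mpol_carrier_trinomial in blast)
    moreover have "0 \<in> ?I" using I.zero_closed by simp
    ultimately show ?thesis using 0 by auto
  qed
  ultimately have "?I \<subseteq> {f \<in> ?I. jac ?V g f \<in> ?I}"
    by (subst (1) trinomial_ideal_def) (rule P.genideal_minimal)
  then show ?thesis using f by auto
qed

lemma derivation_exists:
  fixes a :: "nat \<Rightarrow> 'k::comm_ring_1"
  assumes g: "\<And>v. v \<in> tvars r m ns \<Longrightarrow> g v \<in> carrier (mpol_ring (tvars r m ns))"
    and 0: "\<And>i. i \<in> {1..<r} \<Longrightarrow> jac (tvars r m ns) g (trinomial ns l a i) = 0"
  shows "\<exists>\<delta>. derivation_with_values r m ns l a g \<delta>"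
proof -
  let ?V = "tvars r m ns"
  let ?P = "mpol_ring ?V :: 'k mpol ring"
  let ?I = "trinomial_ideal r m ns l a"
  let ?c = "residue_cl r m ns l a"
  let ?R = "trinomial_algebra r m ns l a"
  define \<delta> where "\<delta> Z = ?c (jac ?V g (SOME f. f \<in> carrier ?P \<and> ?c f = Z))" for Z
  interpret P: cring ?P by (rule mpol_ring_cring)
  interpret I: ideal ?I ?P by (rule ideal_trinomial_ideal)
  interpret h: ring_hom_ring ?P ?R ?c
    using I.rcos_ring_hom_ring
    unfolding trinomial_algebra_def residue_cl_def by simp
  have eq_iff: "?c f = ?c f' \<longleftrightarrow> f - f' \<in> ?I" if "f \<in> carrier ?P" "f' \<in> carrier ?P" for f f'
  proof -
    have "f \<ominus>\<^bsub>?P\<^esub> f' = f - f'"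
    proof -
      have "\<ominus>\<^bsub>?P\<^esub> f' = - f'"
        using that by (intro P.minus_equality) (auto simp: mpol_carrier_uminus)
      then show ?thesis by (simp add: a_minus_def)
    qed
    then show ?thesis
      using P.quotient_eq_iff_same_a_r_cos[OF ideal_trinomial_ideal that] 
      unfolding residue_cl_def by simp
  qed
  have \<delta>: "\<delta> (?c f) = ?c (jac ?V g f)" if f: "f \<in> carrier ?P" for f
  proof -
    let ?f = "SOME f'. f' \<in> carrier ?P \<and> ?c f' = ?c f"
    have f': "?f \<in> carrier ?P \<and> ?c ?f = ?c f"
      by (rule someI) (use f in auto)
    then have "jac ?V g (?f - f) \<in> ?I"
      using eq_iff f by (intro jac_trinomial_ideal g 0) auto
    then show ?thesis
      unfolding \<delta>_def using f f' by (subst eq_iff) (auto simp: jac_diff intro: mpol_carrier_jac g)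
  qed
  have surj: "\<exists>f\<in>carrier ?P. Z = ?c f" if "Z \<in> carrier ?R" for Z
    using that unfolding trinomial_algebra_def FactRing_def residue_cl_def A_RCOSETS_def'
    by auto
  have "derivation_on (\<lambda>c. ?c (Const c)) ?R \<delta>"
    unfolding derivation_on_def
  proof (intro conjI ballI allI)
    show "\<delta> \<in> carrier ?R \<rightarrow> carrier ?R"
    proof
      fix Z assume "Z \<in> carrier ?R"
      then obtain f where "f \<in> carrier ?P" "Z = ?c f" using surj by auto
      then show "\<delta> Z \<in> carrier ?R" using mpol_carrier_jac[of f ?V g] g \<delta> by auto
    qed
  next
    fix Z Y assume "Z \<in> carrier ?R" "Y \<in> carrier ?R"
    then obtain x y where [simp]: "Z = ?c x" "Y = ?c y" and xy [simp]: "x \<in> carrier ?P" "y \<in> carrier ?P"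
      using surj by metis
    have [simp]: "jac ?V g x \<in> carrier ?P" "jac ?V g y \<in> carrier ?P"
      by (auto intro: mpol_carrier_jac g)
    have "\<delta> (?c (x \<oplus>\<^bsub>?P\<^esub> y)) = ?c (jac ?V g x \<oplus>\<^bsub>?P\<^esub> jac ?V g y)"
      using \<delta>[of "x + y"] by (simp add: jac_add mpol_carrier_add del: h.hom_add)
    then show "\<delta> (Z \<oplus>\<^bsub>?R\<^esub> Y) = \<delta> Z \<oplus>\<^bsub>?R\<^esub> \<delta> Y"
      by (simp only: h.hom_add \<delta> \<open>Z = ?c x\<close> \<open>Y = ?c y\<close> xy
            \<open>jac ?V g x \<in> carrier ?P\<close> \<open>jac ?V g y \<in> carrier ?P\<close>)
    have "\<delta> (?c (x \<otimes>\<^bsub>?P\<^esub> y)) = 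
        ?c ((jac ?V g x \<otimes>\<^bsub>?P\<^esub> y) \<oplus>\<^bsub>?P\<^esub> (x \<otimes>\<^bsub>?P\<^esub> jac ?V g y))"
      using \<delta>[of "x * y"] by (simp add: jac_mult mpol_carrier_mult del: h.hom_add h.hom_mult)
    then show "\<delta> (Z \<otimes>\<^bsub>?R\<^esub> Y) = (\<delta> Z \<otimes>\<^bsub>?R\<^esub> Y) \<oplus>\<^bsub>?R\<^esub> (Z \<otimes>\<^bsub>?R\<^esub> \<delta> Y)"
      by (simp only: h.hom_add h.hom_mult \<delta> \<open>Z = ?c x\<close> \<open>Y = ?c y\<close> xy P.m_closed
            \<open>jac ?V g x \<in> carrier ?P\<close> \<open>jac ?V g y \<in> carrier ?P\<close>)
  next
    fix c :: 'k and Z assume "Z \<in> carrier ?R"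
    then obtain x where [simp]: "Z = ?c x" and x [simp]: "x \<in> carrier ?P"
      using surj by metis
    have [simp]: "jac ?V g x \<in> carrier ?P"
      by (auto intro: mpol_carrier_jac g)
    have "\<delta> (?c (Const c \<otimes>\<^bsub>?P\<^esub> x)) = ?c (Const c \<otimes>\<^bsub>?P\<^esub> jac ?V g x)"
      using \<delta>[of "Const c * x"] by (simp add: jac_mult mpol_carrier_mult del: h.hom_mult)
    then show "\<delta> (?c (Const c) \<otimes>\<^bsub>?R\<^esub> Z) = ?c (Const c) \<otimes>\<^bsub>?R\<^esub> \<delta> Z"
      by (simp only: h.hom_mult \<delta> \<open>Z = ?c x\<close> x mpol_carrier_Const
            \<open>jac ?V g x \<in> carrier ?P\<close>)
  qed
  moreover have "\<delta> (?c (Var v)) = ?c (g v)" if "v \<in> ?V" for v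
    using that by (simp add: \<delta> mpol_carrier_Var jac_Var finite_tvars)
  ultimately show ?thesis unfolding derivation_with_values_def by auto
qed

lemma partial_deriv_prod_0:
  "(\<And>x. x \<in> A \<Longrightarrow> partial_deriv v (f x) = 0) \<Longrightarrow> partial_deriv v (prod f A) = 0"
  by (induction A rule: infinite_finite_induct) (auto simp: partial_deriv_mult)

lemma partial_deriv_power_0:
  "partial_deriv v f = 0 \<Longrightarrow> partial_deriv v (f ^ n) = 0"
  by (induction n) (auto simp: partial_deriv_mult)

lemma partial_deriv_T_mono_0:
  "(\<And>j. j \<in> {1..ns i} \<Longrightarrow> v \<noteq> Tvar i j) \<Longrightarrow> partial_deriv v (T_mono ns l i) = 0"
  unfolding T_mono_def
  by (intro partial_deriv_prod_0 partial_deriv_power_0) (auto simp: partial_deriv_Var)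

lemma is_partial_S_exists: "\<exists>\<delta>. is_partial_S r m ns l a p \<delta>"
  unfolding is_partial_S_def
proof (rule derivation_exists)
  fix i assume "i \<in> {1..<r}"
  show "jac (tvars r m ns) (\<lambda>v. case v of Tvar i j \<Rightarrow> 0 | Svar k \<Rightarrow> if k = p then 1 else 0)
         (trinomial ns l a i) = 0"
    unfolding trinomial_def jac_diff
    unfolding jac_def
    by (simp add: sum.neutral partial_deriv_T_mono_0 split: tvar.split)
qed (auto split: tvar.split)

lemma is_delta_exists:
  fixes a :: "nat \<Rightarrow> 'k::comm_ring_1"
  assumes C: "admissible_tuple r ns l C" shows "\<exists>\<delta>. is_delta r m ns l a C \<delta>"
  unfolding is_delta_def
proof (rule derivation_exists)
  let ?d = "\<lambda>k. partial_deriv (Tvar k (C k)) (T_mono ns l k) :: 'k mpol"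
  let ?g = "\<lambda>v. case v of Tvar i j \<Rightarrow> if j = C i then \<Prod>k\<in>{1..r} - {i}. ?d k else 0 | Svar k \<Rightarrow> 0"
  let ?V = "tvars r m ns"
  show "?g v \<in> carrier (mpol_ring (tvars r m ns))" for v
    by (auto split: tvar.split intro!: mpol_carrier_prod mpol_carrier_partial_deriv mpol_carrier_T_mono)
  have *: "jac ?V ?g (T_mono ns l i) = (\<Prod>k\<in>{1..r}. ?d k)" if i: "i \<in> {1..r}" for i
  proof -
    have "Tvar i (C i) \<in> ?V" using C i by (auto simp: admissible_tuple_def tvars_def)
    have "?g v * partial_deriv v (T_mono ns l i) = 0" if "v \<noteq> Tvar i (C i)" for v
    proof (cases v)
      case (Tvar i' j)
      then show ?thesis using that
        by (cases "i' = i") (auto simp: partial_deriv_T_mono_0)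
    qed simp
    then have "jac ?V ?g (T_mono ns l i) =
        (\<Sum>v\<in>{Tvar i (C i)}. ?g v * partial_deriv v (T_mono ns l i))"
      unfolding jac_def using \<open>Tvar i (C i) \<in> ?V\<close> finite_tvars
      by (intro sum.mono_neutral_right) auto
    also have "\<dots> = (\<Prod>k\<in>{1..r}. ?d k)"
      using i by (subst prod.remove[of "{1..r}" i ?d]) (auto simp: mult.commute)
    finally show ?thesis .
  qed
  show "jac ?V ?g (trinomial ns l a i) = 0" if "i \<in> {1..<r}" for i
  proof -
    have "i \<in> {1..r}" "i + 1 \<in> {1..r}" using that by auto
    then show ?thesis unfolding trinomial_def jac_diff using * by simp
  qed
qed

end

theory Submission
  imports Defs
begin

text \<open>Write \<open>u\<^sub>i\<close> for the block monomial \<open>T_mono ns l i\<close>. In the algebra every \<open>u\<^sub>i\<close> is \<open>u\<^sub>1\<close> plus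
  a constant, and two monomials have the same degree iff they differ by a Laurent monomial in the
  \<open>u\<^sub>i\<close>. So the homogeneous elements are exactly the products of a monomial and a polynomial \<open>F(u\<^sub>1)\<close>.
  For \<open>\<partial>/\<partial>S\<^sub>p\<close>, multiplying the derivative back by \<open>S\<^sub>p\<close> gives a nonzero multiple of the element
  itself as soon as \<open>S\<^sub>p\<close> occurs in the monomial. For \<open>\<delta>\<^sub>C\<close>, evaluating at the points of the variety
  with nonzero coordinates turns \<open>\<delta>\<^sub>C h = 0\<close> into \<open>F'(s)/F(s) + \<Sum>\<^sub>i (b\<^sub>i/l\<^sub>i)/(s - e\<^sub>i) = 0\<close>, where \<open>s\<close> is
  the value of \<open>u\<^sub>1\<close>, \<open>e\<^sub>i = a\<^sub>i - a\<^sub>1\<close>, and \<open>l\<^sub>i\<close>, \<open>b\<^sub>i\<close> are the exponents of the variable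
  \<open>Tvar i (C i)\<close> in \<open>u\<^sub>i\<close> and in the monomial. Comparing the coefficients of \<open>1/s\<close> at infinity yields
  \<open>deg F + \<Sum>\<^sub>i b\<^sub>i/l\<^sub>i = 0\<close>, so \<open>F\<close> is constant and all \<open>b\<^sub>i\<close> vanish.\<close>


section \<open>Polynomials as functions\<close>

text \<open>Coordinates outside \<open>V\<close> drop out of every monomial, so
  \<open>ev V x\<close> respects sums and products of arbitrary polynomials without a carrier
  condition.\<close>

definition ev :: "tvar set \<Rightarrow> (tvar \<Rightarrow> 'k) \<Rightarrow> 'k::comm_ring_1 mpol \<Rightarrow> 'k" where
  "ev V x f = (\<Sum>u\<in>Poly_Mapping.keys f.
     Poly_Mapping.lookup f u * (\<Prod>v\<in>V. x v ^ Poly_Mapping.lookup u v))"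

lemma ev_superset:
  assumes "finite A" "Poly_Mapping.keys f \<subseteq> A"
  shows "ev V x f =
    (\<Sum>u\<in>A. Poly_Mapping.lookup f u * (\<Prod>v\<in>V. x v ^ Poly_Mapping.lookup u v))"
  unfolding ev_def using assms
  by (intro sum.mono_neutral_left) (auto simp: in_keys_iff)

lemma ev_add: "ev V x (f + g) = ev V x f + ev V x g"
proof -
  let ?A = "Poly_Mapping.keys f \<union> Poly_Mapping.keys g"
  have "ev V x (f + g) = (\<Sum>u\<in>?A. Poly_Mapping.lookup (f + g) u *
      (\<Prod>v\<in>V. x v ^ Poly_Mapping.lookup u v))"
    by (intro ev_superset keys_add) auto
  also have "\<dots> = ev V x f + ev V x g"
    by (subst (1 2) ev_superset[of ?A]) (auto simp: lookup_add algebra_simps sum.distrib)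
  finally show ?thesis .
qed

lemma ev_0 [simp]: "ev V x 0 = 0"
  by (simp add: ev_def)

lemma ev_uminus: "ev V x (- f) = - ev V x f"
  using ev_add[of V x f "- f"] by (simp add: minus_unique)

lemma ev_diff: "ev V x (f - g) = ev V x f - ev V x g"
  using ev_add[of V x f "- g"] by (simp add: ev_uminus)

lemma ev_sum: "ev V x (sum f A) = (\<Sum>i\<in>A. ev V x (f i))"
  by (induction A rule: infinite_finite_induct) (auto simp: ev_add)

lemma ev_single:
  "ev V x (Poly_Mapping.single u c) = c * (\<Prod>v\<in>V. x v ^ Poly_Mapping.lookup u v)"
  by (cases "c = 0") (auto simp: ev_def)

lemma ev_mult: "ev V x (f * g) = ev V x f * ev V x g"
proof -
  let ?F = "\<lambda>f u. Poly_Mapping.single u (Poly_Mapping.lookup f u)"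
  have "f * g = (\<Sum>u\<in>Poly_Mapping.keys f. \<Sum>w\<in>Poly_Mapping.keys g. ?F f u * ?F g w)"
    by (subst mpol_expand[of f], subst mpol_expand[of g]) (rule sum_product)
  then have "ev V x (f * g) =
      (\<Sum>u\<in>Poly_Mapping.keys f. \<Sum>w\<in>Poly_Mapping.keys g. ev V x (?F f u) * ev V x (?F g w))"
    by (simp add: ev_sum mult_single ev_single lookup_add power_add prod.distrib mult_ac)
  also have "\<dots> = ev V x (sum (?F f) (Poly_Mapping.keys f)) * ev V x (sum (?F g) (Poly_Mapping.keys g))"
    by (simp only: ev_sum sum_product)
  also have "\<dots> = ev V x f * ev V x g"
    by (simp only: mpol_expand[symmetric])
  finally show ?thesis .
qed

lemma ev_Const [simp]: "ev V x (Const c) = c"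
  by (simp add: Const_def ev_single)

lemma ev_1 [simp]: "ev V x 1 = 1"
  using ev_Const[of V x 1] by (simp only: Const_1)

lemma ev_Var: "finite V \<Longrightarrow> v \<in> V \<Longrightarrow> ev V x (Var v) = x v"
  by (simp add: Var_def ev_single lookup_single when_def if_distrib[of "(^) _"] cong: if_cong)

lemma ev_prod: "ev V x (prod f A) = (\<Prod>i\<in>A. ev V x (f i))"
  by (induction A rule: infinite_finite_induct) (auto simp: ev_mult)

lemma ev_power: "ev V x (f ^ n) = ev V x f ^ n"
  by (induction n) (auto simp: ev_mult)

section \<open>Constants, monomials and induction over polynomials\<close>

lemma Const_0: "Const 0 = 0"
  by (simp add: Const_def)

lemma Const_add: "Const (c + d) = Const c + Const d"
  by (simp add: Const_def single_add)

lemma Const_diff: "Const (c - d) = Const c - Const d"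
  by (simp add: Const_def single_diff)

lemma Const_mult: "Const (c * d) = Const c * Const d"
  by (simp add: Const_def mult_single)

text \<open>Exponents form a plain function, so that they can be added and overwritten without
  maintaining a finite support.\<close>

definition mpol_monom :: "tvar set \<Rightarrow> (tvar \<Rightarrow> nat) \<Rightarrow> 'k::comm_ring_1 mpol" where
  "mpol_monom V b = (\<Prod>v\<in>V. Var v ^ b v)"

lemma Var_power: "Var v ^ n = Poly_Mapping.single (Poly_Mapping.single v n) 1"
  by (induction n) (auto simp: Var_def mult_single simp flip: single_add)

lemma mpol_monom_eq_single:
  "mpol_monom V b = Poly_Mapping.single (\<Sum>v\<in>V. Poly_Mapping.single v (b v)) 1"
  unfolding mpol_monom_def
  by (induction V rule: infinite_finite_induct) (auto simp: Var_power mult_single)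

lemma lookup_sum_single:
  "finite V \<Longrightarrow> Poly_Mapping.lookup (\<Sum>v\<in>V. Poly_Mapping.single v (b v)) w =
     (if w \<in> V then b w else 0)"
  by (simp add: lookup_sum lookup_single when_def)

lemma single_eq_mpol_monom:
  assumes "finite V" "Poly_Mapping.keys u \<subseteq> V"
  shows "Poly_Mapping.single u c = Const c * mpol_monom V (Poly_Mapping.lookup u)"
proof -
  have "(\<Sum>v\<in>V. Poly_Mapping.single v (Poly_Mapping.lookup u v)) = u"
    by (rule poly_mapping_eqI) (use assms in \<open>auto simp: lookup_sum_single in_keys_iff\<close>)
  then show ?thesis by (simp add: mpol_monom_eq_single Const_def mult_single)
qed

lemma mpol_monom_cong: "(\<And>v. v \<in> V \<Longrightarrow> b v = b' v) \<Longrightarrow> mpol_monom V b = mpol_monom V b'"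
  unfolding mpol_monom_def by (rule prod.cong) auto

lemma mpol_monom_add: "mpol_monom V (\<lambda>v. b v + b' v) = mpol_monom V b * mpol_monom V b'"
  by (simp add: mpol_monom_def power_add prod.distrib)

lemma mpol_carrier_monom: "mpol_monom V b \<in> carrier (mpol_ring V)"
  unfolding mpol_monom_def
  by (intro mpol_carrier_prod mpol_carrier_power mpol_carrier_Var)

text \<open>Serves to show that a derivation is determined by its values on the variables: every
  polynomial is a sum of constants times products of variables.\<close>

lemma mpol_induct [consumes 2, case_names Const Var add mult]:
  assumes "finite V" "f \<in> carrier (mpol_ring V)"
    and C: "\<And>c. P (Const c)" and V: "\<And>v. v \<in> V \<Longrightarrow> P (Var v)"
    and A: "\<And>f g. \<lbrakk>f \<in> carrier (mpol_ring V); g \<in> carrier (mpol_ring V); P f; P g\<rbrakk> \<Longrightarrow> P (f + g)"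
    and M: "\<And>f g. \<lbrakk>f \<in> carrier (mpol_ring V); g \<in> carrier (mpol_ring V); P f; P g\<rbrakk> \<Longrightarrow> P (f * g)"
  shows "P f"
proof -
  let ?S = "{f \<in> carrier (mpol_ring V). P f}"
  have zero: "0 \<in> ?S" and one: "1 \<in> ?S"
    using C[of 0] C[of 1] by (auto simp: Const_0 Const_1)
  have add: "f + g \<in> ?S" if "f \<in> ?S" "g \<in> ?S" for f g
    using that A mpol_carrier_add by auto
  have mult: "f * g \<in> ?S" if "f \<in> ?S" "g \<in> ?S" for f g
    using that M mpol_carrier_mult by auto
  have sum: "sum h B \<in> ?S" if "\<And>i. i \<in> B \<Longrightarrow> h i \<in> ?S" for h :: "(tvar \<Rightarrow>\<^sub>0 nat) \<Rightarrow> 'a mpol" and B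
    using that by (induction B rule: infinite_finite_induct) (use zero add in auto)
  have prod: "prod h B \<in> ?S" if "\<And>i. i \<in> B \<Longrightarrow> h i \<in> ?S" for h :: "tvar \<Rightarrow> 'a mpol" and B
    using that by (induction B rule: infinite_finite_induct) (use one mult in auto)
  have pow: "h ^ k \<in> ?S" if "h \<in> ?S" for h k
    by (induction k) (use that one mult in auto)
  have "(\<Sum>u\<in>Poly_Mapping.keys f. Poly_Mapping.single u (Poly_Mapping.lookup f u)) \<in> ?S"
  proof (rule sum)
    fix u assume "u \<in> Poly_Mapping.keys f"
    then have "Poly_Mapping.keys u \<subseteq> V" using assms(2) by (auto simp: mpol_ring_carrier)
    moreover have "Const c * mpol_monom V b \<in> ?S" for c b
      unfolding mpol_monom_def using C V
      by (intro mult prod pow) (auto intro: mpol_carrier_Var)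
    ultimately show "Poly_Mapping.single u (Poly_Mapping.lookup f u) \<in> ?S"
      using single_eq_mpol_monom[OF assms(1)] by metis
  qed
  then show ?thesis using mpol_expand[of f] by simp
qed

section \<open>Vector fields on powers and monomials\<close>

lemma jac_1 [simp]: "jac V g 1 = 0"
  by (simp add: jac_def)

lemma jac_power: "jac V g (f ^ n) = of_nat n * f ^ (n - 1) * jac V g f"
proof (induction n)
  case (Suc n)
  then show ?case by (cases n) (auto simp: jac_mult algebra_simps)
qed simp

text \<open>Makes the rules for \<open>jac\<close>, such as \<open>jac_power\<close> and
  \<open>ev_jac_monom\<close>, available for partial derivatives.\<close>

lemma jac_eq_partial_deriv:
  "finite V \<Longrightarrow> v \<in> V \<Longrightarrow> jac V (\<lambda>w. if w = v then 1 else 0) f = partial_deriv v f"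
  by (simp add: jac_def if_distrib[of "\<lambda>x. x * _"] cong: if_cong)

text \<open>At a point where no variable vanishes, \<open>ev (jac f) / ev f\<close> is a logarithmic derivative,
  hence additive on products.\<close>

lemma ev_jac_monom:
  fixes x :: "tvar \<Rightarrow> 'k::field"
  assumes V: "finite V" and x: "\<And>v. v \<in> V \<Longrightarrow> x v \<noteq> 0"
  shows "ev V x (jac V g (mpol_monom V b)) =
    ev V x (mpol_monom V b) * (\<Sum>v\<in>V. of_nat (b v) * ev V x (g v) / x v)"
proof -
  \<comment> \<open>The monomial is built up over subsets \<open>W\<close>, while evaluation and
    vector field keep referring to the full \<open>V\<close>.\<close>
  have "ev V x (jac V g (\<Prod>v\<in>W. Var v ^ b v)) =
      (\<Prod>v\<in>W. x v ^ b v) * (\<Sum>v\<in>W. of_nat (b v) * ev V x (g v) / x v)" if "W \<subseteq> V" for W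
    using finite_subset[OF that V] that
  proof (induction W rule: finite_induct)
    case (insert w W)
    have w: "x w \<noteq> 0" "ev V x (Var w) = x w" "jac V g (Var w) = g w"
      using insert x by (auto simp: ev_Var jac_Var V)
    have ofn: "ev V x (of_nat k) = of_nat k" for k
      by (induction k) (auto simp: ev_add)
    have W: "ev V x (\<Prod>v\<in>W. Var v ^ b v) = (\<Prod>v\<in>W. x v ^ b v)"
      unfolding ev_prod ev_power using insert by (intro prod.cong) (auto simp: ev_Var V)
    have "ev V x (jac V g (Var w ^ b w)) = x w ^ b w * (of_nat (b w) * ev V x (g w) / x w)"
    proof -
      have "ev V x (jac V g (Var w ^ b w)) = of_nat (b w) * x w ^ (b w - 1) * ev V x (g w)"
        by (simp only: jac_power ev_mult ev_power ofn w)
      \<comment> \<open>For \<open>b w = 0\<close> both sides vanish; otherwise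
        \<open>x w \<noteq> 0\<close> turns the truncated exponent \<open>b w - 1\<close> into a
        division by \<open>x w\<close>.\<close>
      then show ?thesis using w by (cases "b w") (simp_all del: of_nat_Suc)
    qed
    then show ?case
      using insert by (simp add: jac_mult ev_add ev_mult W ev_power w algebra_simps)
  qed simp
  from this[of V] show ?thesis
    by (simp add: mpol_monom_def ev_prod ev_power ev_Var V)
qed


section \<open>Substitution into univariate polynomials\<close>

lemma map_poly_Const_pCons: "map_poly Const (pCons c p) = pCons (Const c) (map_poly Const p)"
  by (simp add: map_poly_pCons Const_0)

lemma map_poly_Const_add:
  "map_poly Const (p + q) = map_poly Const p + map_poly Const q"
  by (rule poly_eqI) (simp add: coeff_map_poly Const_0 Const_add)

lemma map_poly_Const_smult:
  "map_poly Const (Polynomial.smult c q) = Polynomial.smult (Const c) (map_poly Const q)"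
  by (rule poly_eqI) (simp add: coeff_map_poly Const_0 Const_mult)

lemma map_poly_Const_mult:
  "map_poly Const (p * q) = map_poly Const p * map_poly Const q"
  by (induction p) (simp_all add: map_poly_Const_pCons map_poly_Const_add map_poly_Const_smult
      mult_pCons_left Const_0)

lemma map_poly_Const_1: "map_poly Const 1 = 1"
  by (simp add: Const_1)

lemma map_poly_Const_prod:
  "map_poly Const (prod p A) = (\<Prod>i\<in>A. map_poly Const (p i))"
  by (induction A rule: infinite_finite_induct)
     (simp_all add: map_poly_Const_mult map_poly_Const_1)

lemma map_poly_Const_power: "map_poly Const (p ^ n) = map_poly Const p ^ n"
  by (induction n) (simp_all add: map_poly_Const_mult map_poly_Const_1)

lemma mpol_carrier_poly:
  "t \<in> carrier (mpol_ring V) \<Longrightarrow> poly (map_poly Const F) t \<in> carrier (mpol_ring V)"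
  by (induction F) (auto simp: map_poly_Const_pCons mpol_carrier_add mpol_carrier_mult)

lemma ev_poly: "ev V x (poly (map_poly Const F) t) = poly F (ev V x t)"
  by (induction F) (auto simp: map_poly_Const_pCons ev_add ev_mult)

text \<open>The chain rule, proved along Horner's scheme; it brings in the ordinary derivative of
  \<open>F\<close>.\<close>

lemma ev_jac_poly:
  "ev V x (jac V g (poly (map_poly Const F) t)) = poly (pderiv F) (ev V x t) * ev V x (jac V g t)"
  by (induction F)
    (auto simp: map_poly_Const_pCons jac_add jac_mult ev_add ev_mult ev_poly pderiv_pCons algebra_simps)

text \<open>Upper bounds on the degrees are what is available in
  \<open>log_derivative_identity\<close>, where the top coefficient of a factor may be 0.\<close>

lemma coeff_mult_degree_le:
  fixes p q :: "'a::comm_semiring_0 poly"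
  assumes "Polynomial.degree p \<le> i" "Polynomial.degree q \<le> j"
  shows "Polynomial.coeff (p * q) (i + j) = Polynomial.coeff p i * Polynomial.coeff q j"
proof -
  have "Polynomial.coeff (p * q) (i + j) =
      (\<Sum>k\<in>{i}. Polynomial.coeff p k * Polynomial.coeff q (i + j - k))"
    unfolding coeff_mult
  proof (intro sum.mono_neutral_right ballI)
    fix k assume "k \<in> {..i + j} - {i}"
    then have "k > i \<or> i + j - k > j" by auto
    then show "Polynomial.coeff p k * Polynomial.coeff q (i + j - k) = 0"
      using assms by (auto simp: coeff_eq_0)
  qed auto
  then show ?thesis by simp
qed

text \<open>Clearing denominators turns the hypothesis into a polynomial with infinitely many zeros.
  It is therefore 0, and its top coefficient is the leading coefficient of \<open>F\<close> times
  the sum in question.\<close>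

lemma log_derivative_identity:
  fixes F :: "'k::field_char_0 poly"
  assumes A: "finite A" and F: "F \<noteq> 0"
    and 0: "\<And>s. s \<notin> e ` A \<Longrightarrow> poly (pderiv F) s + poly F s * (\<Sum>i\<in>A. c i / (s - e i)) = 0"
  shows "of_nat (Polynomial.degree F) + (\<Sum>i\<in>A. c i) = 0"
proof -
  define L where "L B = (\<Prod>i\<in>B. [:- e i, 1:])" for B
  define n where "n = Polynomial.degree F"
  \<comment> \<open>\<open>L A\<close> is the common denominator. The extra factor \<open>s\<close>,
    entered by \<open>pCons 0\<close>, lets both summands reach degree \<open>n + card A\<close>, so
    no degree has to be lowered by 1.\<close>
  define q where "q = pCons 0 (pderiv F) * L A
    + F * (\<Sum>i\<in>A. Polynomial.smult (c i) (pCons 0 (L (A - {i}))))"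
  have degL: "Polynomial.degree (L B) = card B" for B
    unfolding L_def by (subst degree_prod_eq_sum_degree) auto
  have lcL: "Polynomial.coeff (L B) (card B) = 1" for B
    using lead_coeff_prod[of "\<lambda>i. [:- e i, 1:]" B] by (simp add: degL flip: L_def)
  have deg1: "Polynomial.degree (pCons 0 (L (A - {i}))) \<le> card A"
    and coeff1: "Polynomial.coeff (pCons 0 (L (A - {i}))) (card A) = 1" if "i \<in> A" for i
  proof -
    have "card A = Suc (card (A - {i}))" using A that by (rule card.remove)
    then show "Polynomial.degree (pCons 0 (L (A - {i}))) \<le> card A"
      "Polynomial.coeff (pCons 0 (L (A - {i}))) (card A) = 1"
      using lcL[of "A - {i}"] degree_pCons_le[of 0 "L (A - {i})"] by (simp_all only: degL coeff_pCons_Suc)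
  qed
  have "poly q s = 0" if s: "s \<notin> e ` A" for s
  proof -
    have nz: "s - e i \<noteq> 0" if "i \<in> A" for i using s that by auto
    have L: "poly (L B) s = (\<Prod>i\<in>B. s - e i)" for B
      by (simp add: L_def poly_prod)
    have L': "poly (L (A - {i})) s = poly (L A) s / (s - e i)" if "i \<in> A" for i
      using nz[OF that] that A by (simp add: L prod.remove)
    have "poly q s = s * poly (pderiv F) s * poly (L A) s
        + poly F s * (\<Sum>i\<in>A. c i * (s * (poly (L A) s / (s - e i))))"
      unfolding q_def using L' by (simp add: poly_sum mult_ac cong: sum.cong)
    also have "(\<Sum>i\<in>A. c i * (s * (poly (L A) s / (s - e i)))) =
        s * poly (L A) s * (\<Sum>i\<in>A. c i / (s - e i))"
      by (simp add: sum_distrib_left mult_ac)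
    finally have "poly q s = s * poly (L A) s *
        (poly (pderiv F) s + poly F s * (\<Sum>i\<in>A. c i / (s - e i)))"
      by (simp only: distrib_left mult_ac)
    then show ?thesis using 0[OF s] by simp
  qed
  then have "infinite {s. poly q s = 0}"
    using A infinite_UNIV_char_0[where 'a = 'k] Diff_infinite_finite[of "e ` A" UNIV]
    by (metis (mono_tags, lifting) DiffE finite_imageI infinite_super mem_Collect_eq subsetI)
  then have "q = 0" using poly_roots_finite by blast
  \<comment> \<open>At this degree the first product contributes \<open>of_nat n\<close> and the
    second the sum of the \<open>c i\<close>, each times the leading coefficient of
    \<open>F\<close>.\<close>
  then have "0 = Polynomial.coeff q (n + card A)" by simp
  also have "\<dots> = Polynomial.coeff (pCons 0 (pderiv F)) n * Polynomial.coeff (L A) (card A)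
      + Polynomial.coeff F n *
        Polynomial.coeff (\<Sum>i\<in>A. Polynomial.smult (c i) (pCons 0 (L (A - {i})))) (card A)"
    unfolding q_def Polynomial.coeff_add
  proof (subst (1 2) coeff_mult_degree_le)
    show "Polynomial.degree (pCons 0 (pderiv F)) \<le> n"
      by (auto simp: degree_pCons_eq_if degree_pderiv n_def pderiv_eq_0_iff)
    show "Polynomial.degree (\<Sum>i\<in>A. Polynomial.smult (c i) (pCons 0 (L (A - {i})))) \<le> card A"
      using A deg1 by (intro degree_sum_le order.trans[OF degree_smult_le])
  qed (auto simp: degL n_def)
  also have "Polynomial.coeff (pCons 0 (pderiv F)) n = of_nat n * Polynomial.coeff F n"
    by (cases n) (auto simp: coeff_pderiv)
  also have "Polynomial.coeff (\<Sum>i\<in>A. Polynomial.smult (c i) (pCons 0 (L (A - {i})))) (card A)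
      = (\<Sum>i\<in>A. c i)"
    using coeff1 by (simp add: coeff_sum del: smult_pCons)
  finally have "Polynomial.coeff F n * (of_nat n + (\<Sum>i\<in>A. c i)) = 0"
    by (simp add: lcL algebra_simps)
  then show ?thesis using F by (simp add: n_def)
qed

text \<open>In characteristic zero the rationals embed by \<open>of_rat\<close>, so the equation can
  be read in an ordered field, where a vanishing sum of nonnegative terms has only zero
  terms.\<close>

lemma nonneg_quotients_sum_0:
  assumes "finite A" and "of_nat n + (\<Sum>i\<in>A. of_nat (b i) / of_nat (c i)) = (0 :: 'k::field_char_0)"
    and "\<And>i. i \<in> A \<Longrightarrow> c i > 0"
  shows "n = 0 \<and> (\<forall>i\<in>A. b i = 0)"
proof -
  have "of_rat (of_nat n + (\<Sum>i\<in>A. of_nat (b i) / of_nat (c i))) = (of_rat 0 :: 'k)"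
    using assms(2) by (simp add: of_rat_add of_rat_sum of_rat_divide)
  then have "of_nat n + (\<Sum>i\<in>A. of_nat (b i) / of_nat (c i)) = (0 :: rat)"
    by (simp only: of_rat_eq_iff)
  moreover have "(\<Sum>i\<in>A. of_nat (b i) / of_nat (c i)) \<ge> (0 :: rat)"
    by (intro sum_nonneg) auto
  ultimately have n: "n = 0" and s: "(\<Sum>i\<in>A. of_nat (b i) / of_nat (c i)) = (0 :: rat)"
    by (auto simp: add_nonneg_eq_0_iff)
  have "\<forall>i\<in>A. of_nat (b i) / of_nat (c i) = (0 :: rat)"
    using s assms(1) by (subst (asm) sum_nonneg_eq_0_iff) auto
  then show ?thesis
    using n assms(3) by (metis divide_eq_0_iff of_nat_eq_0_iff less_numeral_extra(3))
qed


section \<open>Computing in the trinomial algebra\<close>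

text \<open>The \<open>i\<close>-th row of \<open>P0\<close> with entries in \<open>nat\<close>; it
  is the exponent function of the \<open>i\<close>-th block monomial.\<close>

definition block_exp :: "(nat \<Rightarrow> nat \<Rightarrow> nat) \<Rightarrow> nat \<Rightarrow> tvar \<Rightarrow> nat" where
  "block_exp l i v = (case v of Tvar i' j \<Rightarrow> if i' = i then l i j else 0 | Svar k \<Rightarrow> 0)"

text \<open>The values prescribed in \<open>is_delta\<close>, read as a vector field:
  \<open>jac V\<close> of it lifts the derivation to polynomials.\<close>

definition delta_field ::
  "nat \<Rightarrow> (nat \<Rightarrow> nat) \<Rightarrow> (nat \<Rightarrow> nat \<Rightarrow> nat) \<Rightarrow> (nat \<Rightarrow> nat) \<Rightarrow> tvar \<Rightarrow> 'k::comm_ring_1 mpol" where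
  "delta_field r ns l C v = (case v of
     Tvar i j \<Rightarrow> if j = C i
       then (\<Prod>k\<in>{1..r} - {i}. partial_deriv (Tvar k (C k)) (T_mono ns l k)) else 0
   | Svar k \<Rightarrow> 0)"

locale trinomial_data =
  fixes r m :: nat and ns :: "nat \<Rightarrow> nat" and l :: "nat \<Rightarrow> nat \<Rightarrow> nat"
    and a :: "nat \<Rightarrow> 'k::{alg_closed_field, field_char_0}"
  assumes r_pos: "r > 0"
    and ns_pos: "\<And>i. i \<in> {1..r} \<Longrightarrow> ns i > 0"
    and l_pos: "\<And>i j. i \<in> {1..r} \<Longrightarrow> j \<in> {1..ns i} \<Longrightarrow> l i j > 0"
begin

abbreviation V where "V \<equiv> tvars r m ns"
abbreviation P :: "'k mpol ring" where "P \<equiv> mpol_ring V"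
abbreviation I where "I \<equiv> trinomial_ideal r m ns l a"
abbreviation R where "R \<equiv> trinomial_algebra r m ns l a"
abbreviation cl where "cl \<equiv> residue_cl r m ns l a"
abbreviation T :: "nat \<Rightarrow> 'k mpol" where "T \<equiv> T_mono ns l"

section \<open>The quotient map and congruences modulo the ideal\<close>

sublocale P: cring P
  by (rule mpol_ring_cring)

sublocale I: ideal I P
  by (rule ideal_trinomial_ideal)

sublocale cl: ring_hom_ring P R cl
  using I.rcos_ring_hom_ring unfolding trinomial_algebra_def residue_cl_def by simp

lemma T_carrier: "i \<in> {1..r} \<Longrightarrow> T i \<in> carrier P"
  by (rule mpol_carrier_T_mono)

lemma one_index: "1 \<in> {1..r}"
  using r_pos by auto

lemma cl_eq_iff:
  assumes "f \<in> carrier P" "f' \<in> carrier P"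
  shows "cl f = cl f' \<longleftrightarrow> f - f' \<in> I"
proof -
  have "\<ominus>\<^bsub>P\<^esub> f' = - f'"
    using assms by (intro P.minus_equality) (auto simp: mpol_carrier_uminus)
  then have "f \<ominus>\<^bsub>P\<^esub> f' = f - f'" by (simp add: a_minus_def)
  then show ?thesis
    using P.quotient_eq_iff_same_a_r_cos[OF ideal_trinomial_ideal assms]
    unfolding residue_cl_def by simp
qed

lemma cl_eq_zero_iff: "f \<in> carrier P \<Longrightarrow> cl f = \<zero>\<^bsub>R\<^esub> \<longleftrightarrow> f \<in> I"
  using cl_eq_iff[of f 0] cl.hom_zero by simp

lemma cl_add: "f \<in> carrier P \<Longrightarrow> g \<in> carrier P \<Longrightarrow> cl (f + g) = cl f \<oplus>\<^bsub>R\<^esub> cl g"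
  using cl.hom_add[of f g] by simp

lemma cl_mult: "f \<in> carrier P \<Longrightarrow> g \<in> carrier P \<Longrightarrow> cl (f * g) = cl f \<otimes>\<^bsub>R\<^esub> cl g"
  using cl.hom_mult[of f g] by simp

lemma I_add: "f \<in> I \<Longrightarrow> g \<in> I \<Longrightarrow> f + g \<in> I"
  using I.a_closed[of f g] by simp

lemma I_mult: "f \<in> I \<Longrightarrow> g \<in> carrier P \<Longrightarrow> g * f \<in> I"
  using I.I_l_closed[of f g] by simp

lemma I_0: "0 \<in> I"
  using I.zero_closed by simp

lemma cl_power_cong:
  assumes "f \<in> carrier P" "f' \<in> carrier P" "cl f = cl f'"
  shows "cl (f ^ n) = cl (f' ^ n)"
  by (induction n) (simp_all add: cl_mult mpol_carrier_power assms)

lemma cl_prod_cong: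
  assumes "\<And>i. i \<in> A \<Longrightarrow> f i \<in> carrier P" "\<And>i. i \<in> A \<Longrightarrow> f' i \<in> carrier P"
    "\<And>i. i \<in> A \<Longrightarrow> cl (f i) = cl (f' i)"
  shows "cl (prod f A) = cl (prod f' A)"
  using assms
  by (induction A rule: infinite_finite_induct) (simp_all add: cl_mult mpol_carrier_prod)

text \<open>Consecutive blocks are linked by one generator each, so the relations telescope down to
  the first block.\<close>

lemma cl_T: "i \<in> {1..r} \<Longrightarrow> cl (T i) = cl (T 1 + Const (a 1 - a i))"
proof -
  assume "i \<in> {1..r}"
  then have "1 \<le> i" and "i \<le> r" by auto
  then show ?thesis
  proof (induction i rule: dec_induct)
    case base
    show ?case by (simp add: Const_0)
  next
    case (step i)
    have i: "i \<in> {1..<r}" "i \<in> {1..r}" "Suc i \<in> {1..r}" using step by auto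
    have car: "T i \<in> carrier P" "T (Suc i) \<in> carrier P" "T 1 + Const c \<in> carrier P" for c
      using T_carrier i one_index by (auto intro!: mpol_carrier_add)
    have gen: "trinomial ns l a i \<in> I"
    proof -
          have "trinomial ns l a ` {1..<r} \<subseteq> I"
        unfolding trinomial_ideal_def
        by (rule P.genideal_self) (use mpol_carrier_trinomial in blast)
      then show ?thesis using i by blast
    qed
    have "T i - (T 1 + Const (a 1 - a i)) \<in> I"
      using step i car cl_eq_iff[of "T i" "T 1 + Const (a 1 - a i)"] by simp
    \<comment> \<open>Subtracting the generator cancels \<open>T i\<close> and leaves the constant
      \<open>a 1 - a (Suc i)\<close>.\<close>
    from I_add[OF this I_mult[OF gen mpol_carrier_Const, of "- 1"]]
    have "T (Suc i) - (T 1 + Const (a 1 - a (Suc i))) \<in> I"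
      unfolding Const_minus_1_mult trinomial_def by (simp add: Const_diff algebra_simps)
    then show ?case using car cl_eq_iff by simp
  qed
qed

section \<open>Block monomials and their exponent functions\<close>

lemma T_eq_monom: "i \<in> {1..r} \<Longrightarrow> T i = mpol_monom V (block_exp l i)"
proof -
  assume i: "i \<in> {1..r}"
  have "mpol_monom V (block_exp l i) = (\<Prod>v\<in>Tvar i ` {1..ns i}. Var v ^ block_exp l i v)"
    unfolding mpol_monom_def
    by (intro prod.mono_neutral_right finite_tvars)
       (use i in \<open>auto simp: tvars_def block_exp_def image_iff split: tvar.split\<close>)
  also have "\<dots> = T i"
    unfolding T_mono_def by (subst prod.reindex) (auto simp: block_exp_def inj_on_def)
  finally show ?thesis by simp
qed

text \<open>Links products over all variables with the double products over blocks in which the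
  kernels are described.\<close>

lemma mpol_monom_V_eq:
  "mpol_monom V b = (\<Prod>i=1..r. \<Prod>j=1..ns i. Var (Tvar i j) ^ b (Tvar i j))
     * (\<Prod>k=1..m. Var (Svar k) ^ b (Svar k))"
proof -
  let ?A = "SIGMA i:{1..r}. {1..ns i}"
  have V: "V = (\<lambda>(i, j). Tvar i j) ` ?A \<union> Svar ` {1..m}"
    by (auto simp: tvars_def image_iff)
  have "mpol_monom V b = (\<Prod>v\<in>(\<lambda>(i, j). Tvar i j) ` ?A. Var v ^ b v) * (\<Prod>v\<in>Svar ` {1..m}. Var v ^ b v)"
    unfolding mpol_monom_def V by (intro prod.union_disjoint) auto
  also have "(\<Prod>v\<in>(\<lambda>(i, j). Tvar i j) ` ?A. Var v ^ b v) =
      (\<Prod>i=1..r. \<Prod>j=1..ns i. Var (Tvar i j) ^ b (Tvar i j))"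
    by (subst prod.reindex) (auto simp: inj_on_def prod.Sigma case_prod_unfold)
  also have "(\<Prod>v\<in>Svar ` {1..m}. Var v ^ b v) = (\<Prod>k=1..m. Var (Svar k) ^ b (Svar k))"
    by (subst prod.reindex) (auto simp: inj_on_def)
  finally show ?thesis .
qed

text \<open>Turns combinations of rows of \<open>P0\<close>, by which degrees are compared, into
  products of powers of blocks.\<close>

lemma mpol_monom_blocks:
  "mpol_monom V (\<lambda>v. \<Sum>i=1..r. z i * block_exp l i v) = (\<Prod>i=1..r. T i ^ z i)"
proof -
  have "mpol_monom V (\<lambda>v. \<Sum>i=1..r. z i * block_exp l i v) =
      (\<Prod>v\<in>V. \<Prod>i=1..r. Var v ^ (z i * block_exp l i v))"
    by (simp add: mpol_monom_def power_sum)
  also have "\<dots> = (\<Prod>i=1..r. \<Prod>v\<in>V. Var v ^ (z i * block_exp l i v))"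
    by (rule prod.swap)
  also have "\<dots> = (\<Prod>i=1..r. T i ^ z i)"
  proof (rule prod.cong)
    fix i assume "i \<in> {1..r}"
    then have "T i ^ z i = (\<Prod>v\<in>V. (Var v ^ block_exp l i v) ^ z i)"
      by (simp add: T_eq_monom mpol_monom_def prod_power_distrib)
    also have "\<dots> = (\<Prod>v\<in>V. Var v ^ (z i * block_exp l i v))"
      by (simp add: mult.commute flip: power_mult)
    finally show "(\<Prod>v\<in>V. Var v ^ (z i * block_exp l i v)) = T i ^ z i" ..
  qed simp
  finally show ?thesis .
qed

text \<open>The rows of \<open>P0\<close> have disjoint supports, so at most one summand survives.
  The general semiring allows coefficients in both \<open>nat\<close> and
  \<open>int\<close>.\<close>

lemma sum_block_exp:
  fixes z :: "nat \<Rightarrow> 'a::comm_semiring_1"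
  shows "(\<Sum>i=1..r. z i * of_nat (block_exp l i v)) =
    (case v of Tvar i j \<Rightarrow> if i \<in> {1..r} then z i * of_nat (l i j) else 0 | Svar k \<Rightarrow> 0)"
proof (cases v)
  case (Tvar i' j)
  have "(\<Sum>i=1..r. z i * of_nat (block_exp l i v)) =
      (\<Sum>i=1..r. if i' = i then z i * of_nat (l i j) else 0)"
    by (rule sum.cong) (auto simp: block_exp_def Tvar)
  then show ?thesis by (simp add: Tvar)
qed (simp add: block_exp_def)


section \<open>Homogeneous elements\<close>

text \<open>Degrees are cosets of the image of the transpose of \<open>P0\<close>, a subgroup; two
  cosets agree iff the exponent vectors differ by an element of it.\<close>

lemma monom_deg_eq_iff:
  assumes u: "Poly_Mapping.keys u \<subseteq> V" and u': "Poly_Mapping.keys u' \<subseteq> V"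
  shows "monom_deg r m ns l u = monom_deg r m ns l u' \<longleftrightarrow>
    (\<exists>y :: nat \<Rightarrow> int. \<forall>v\<in>V. int (Poly_Mapping.lookup u v) =
       int (Poly_Mapping.lookup u' v) + (\<Sum>i=1..r. y i * int (block_exp l i v)))"
proof -
  \<comment> \<open>\<open>fr w\<close> is the exponent vector \<open>w\<close> with integer
    entries, and \<open>\<phi>\<close> is the transpose of \<open>P0\<close>.\<close>
  define fr where
    "fr w = (\<Sum>v\<in>Poly_Mapping.keys w. frag_cmul (int (Poly_Mapping.lookup w v)) (frag_of v))"
    for w :: "tvar \<Rightarrow>\<^sub>0 nat"
  define \<phi> where "\<phi> y = (\<Sum>v\<in>V. frag_cmul (\<Sum>i=1..r. P0 l i v * y i) (frag_of v))"
    for y :: "nat \<Rightarrow> int"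
  have P0: "P0 l i v = int (block_exp l i v)" for i v
    by (simp add: P0_def block_exp_def split: tvar.split)
  have fr: "Poly_Mapping.lookup (fr w) v = int (Poly_Mapping.lookup w v)" for w v
    unfolding fr_def lookup_sum lookup_frag_cmul
    by (auto simp: if_distrib[of "(*) _"] in_keys_iff cong: if_cong)
  have \<phi>: "Poly_Mapping.lookup (\<phi> y) v =
      (if v \<in> V then \<Sum>i=1..r. y i * int (block_exp l i v) else 0)" for y v
    unfolding \<phi>_def lookup_sum lookup_frag_cmul
    by (simp add: if_distrib[of "(*) _"] finite_tvars P0 cong: if_cong) (simp add: mult.commute)
  have \<phi>_add: "\<phi> y + \<phi> y' = \<phi> (\<lambda>i. y i + y' i)" for y y'
    by (rule poly_mapping_eqI) (simp add: lookup_add \<phi> algebra_simps sum.distrib)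
  have \<phi>_diff: "\<phi> y - \<phi> y' = \<phi> (\<lambda>i. y i - y' i)" for y y'
    by (rule poly_mapping_eqI) (simp add: lookup_minus \<phi> algebra_simps sum_subtractf)
  have deg: "monom_deg r m ns l w = (\<lambda>y. \<phi> y + fr w) ` UNIV" for w
    unfolding monom_deg_def Q_def r_coset_def im_P0T_def fr_def \<phi>_def by auto
  have "monom_deg r m ns l u = monom_deg r m ns l u' \<longleftrightarrow> (\<exists>y. fr u = \<phi> y + fr u')"
  proof
    assume eq: "monom_deg r m ns l u = monom_deg r m ns l u'"
    have "\<phi> (\<lambda>_. 0) = 0"
      by (rule poly_mapping_eqI) (simp add: \<phi>)
    then have "fr u \<in> monom_deg r m ns l u"
      unfolding deg by (intro image_eqI[of _ _ "\<lambda>_. 0"]) auto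
    then show "\<exists>y. fr u = \<phi> y + fr u'" unfolding eq unfolding deg by auto
  next
    assume "\<exists>y. fr u = \<phi> y + fr u'"
    then obtain y where y: "fr u = \<phi> y + fr u'" by auto
    have 1: "\<phi> z + fr u = \<phi> (\<lambda>i. z i + y i) + fr u'" for z
      by (simp add: y add.assoc flip: \<phi>_add)
    have 2: "\<phi> z + fr u' = \<phi> (\<lambda>i. z i - y i) + fr u" for z
      by (simp add: y flip: \<phi>_diff)
    show "monom_deg r m ns l u = monom_deg r m ns l u'"
      unfolding deg
    proof (intro equalityI image_subsetI)
      show "\<phi> z + fr u \<in> range (\<lambda>y. \<phi> y + fr u')" for z
        unfolding 1 by (rule rangeI)
      show "\<phi> z + fr u' \<in> range (\<lambda>y. \<phi> y + fr u)" for z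
        unfolding 2 by (rule rangeI)
    qed
  qed
  also have "(\<exists>y. fr u = \<phi> y + fr u') \<longleftrightarrow>
      (\<exists>y :: nat \<Rightarrow> int. \<forall>v\<in>V. int (Poly_Mapping.lookup u v) =
       int (Poly_Mapping.lookup u' v) + (\<Sum>i=1..r. y i * int (block_exp l i v)))"
  proof -
    have "fr u = \<phi> y + fr u' \<longleftrightarrow> (\<forall>v\<in>V. int (Poly_Mapping.lookup u v) =
       int (Poly_Mapping.lookup u' v) + (\<Sum>i=1..r. y i * int (block_exp l i v)))" for y
    proof -
      \<comment> \<open>Outside \<open>V\<close> all terms vanish, so the comparison can be
        restricted to \<open>V\<close>.\<close>
      have 0: "v \<notin> V \<Longrightarrow> Poly_Mapping.lookup u v = 0 \<and> Poly_Mapping.lookup u' v = 0" for v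
        using u u' by (auto simp: in_keys_iff)
      have "fr u = \<phi> y + fr u' \<longleftrightarrow> (\<forall>v. int (Poly_Mapping.lookup u v) =
          (if v \<in> V then \<Sum>i=1..r. y i * int (block_exp l i v) else 0)
          + int (Poly_Mapping.lookup u' v))"
        by (simp only: poly_mapping_eq_iff fun_eq_iff lookup_add fr \<phi>)
      also have "\<dots> \<longleftrightarrow> (\<forall>v\<in>V. int (Poly_Mapping.lookup u v) =
          int (Poly_Mapping.lookup u' v) + (\<Sum>i=1..r. y i * int (block_exp l i v)))"
        (is "(\<forall>v. ?A v) \<longleftrightarrow> (\<forall>v\<in>V. ?B v)")
      proof -
        have "?A v \<longleftrightarrow> ?B v" if "v \<in> V" for v
          using that by (simp only: if_True add.commute)
        moreover have "?A v" if "v \<notin> V" for v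
          using 0[OF that] that by simp
        ultimately show ?thesis by blast
      qed
      finally show ?thesis .
    qed
    then show ?thesis by simp
  qed
  finally show ?thesis .
qed

text \<open>Every degree contains a least monomial: divide by \<open>T i\<close> as often as possible.\<close>

lemma least_monom_of_degree:
  assumes u0: "Poly_Mapping.keys u0 \<subseteq> V"
  shows "\<exists>b. \<forall>u. Poly_Mapping.keys u \<subseteq> V \<and> monom_deg r m ns l u = monom_deg r m ns l u0 \<longrightarrow>
    (\<exists>z. mpol_monom V (Poly_Mapping.lookup u) = mpol_monom V b * (\<Prod>i=1..r. T i ^ z i))"
proof -
  \<comment> \<open>\<open>q i\<close> is the largest power of \<open>T i\<close> dividing the
    monomial \<open>u0\<close>, and \<open>b\<close> is what remains after all these
    divisions.\<close>
  define q where "q i = Min ((\<lambda>j. Poly_Mapping.lookup u0 (Tvar i j) div l i j) ` {1..ns i})" for i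
  define b where "b v = (case v of
      Tvar i j \<Rightarrow> Poly_Mapping.lookup u0 v - q i * l i j | Svar k \<Rightarrow> Poly_Mapping.lookup u0 v)" for v
  have q_le: "q i * l i j \<le> Poly_Mapping.lookup u0 (Tvar i j)" if "j \<in> {1..ns i}" for i j
  proof -
    have "q i \<le> Poly_Mapping.lookup u0 (Tvar i j) div l i j"
      unfolding q_def using that by (intro Min_le) auto
    then show ?thesis by (meson div_times_less_eq_dividend mult_le_mono1 order.trans)
  qed
  \<comment> \<open>At a minimizing index no further factor \<open>T i\<close> fits.\<close>
  have q_attained: "\<exists>j\<in>{1..ns i}. Poly_Mapping.lookup u0 (Tvar i j) < (q i + 1) * l i j"
    if i: "i \<in> {1..r}" for i
  proof -
    have "q i \<in> (\<lambda>j. Poly_Mapping.lookup u0 (Tvar i j) div l i j) ` {1..ns i}"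
      unfolding q_def using ns_pos[OF i] by (intro Min_in) auto
    then obtain j where j: "j \<in> {1..ns i}" "q i = Poly_Mapping.lookup u0 (Tvar i j) div l i j"
      by auto
    then show ?thesis
      using l_pos[OF i j(1)] dividend_less_div_times[of "l i j" "Poly_Mapping.lookup u0 (Tvar i j)"]
      by (intro bexI[of _ j]) (auto simp: algebra_simps)
  qed
  have "\<exists>z. mpol_monom V (Poly_Mapping.lookup u) = mpol_monom V b * (\<Prod>i=1..r. T i ^ z i)"
    if u: "Poly_Mapping.keys u \<subseteq> V" and eq: "monom_deg r m ns l u = monom_deg r m ns l u0" for u
  proof -
    obtain y :: "nat \<Rightarrow> int" where y: "\<And>v. v \<in> V \<Longrightarrow> int (Poly_Mapping.lookup u v) =
       int (Poly_Mapping.lookup u0 v) + (\<Sum>i=1..r. y i * int (block_exp l i v))"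
      using eq monom_deg_eq_iff[OF u u0] by auto
    define z where "z i = nat (y i + int (q i))" for i
    have yT: "int (Poly_Mapping.lookup u (Tvar i j)) =
        int (Poly_Mapping.lookup u0 (Tvar i j)) + y i * int (l i j)"
      if "i \<in> {1..r}" "j \<in> {1..ns i}" for i j
    proof -
      have "Tvar i j \<in> V" using that by (auto simp: tvars_def)
      from y[OF this] show ?thesis
        using that sum_block_exp[of y "Tvar i j"] by simp
    qed
    \<comment> \<open>The truncation by \<open>nat\<close> cuts nothing off: if
      \<open>y i + q i\<close> were negative, \<open>u\<close> would have a negative exponent at the
      minimizing index.\<close>
    have z: "int (z i) = y i + int (q i)" if i: "i \<in> {1..r}" for i
    proof -
      obtain j where j: "j \<in> {1..ns i}"
          "Poly_Mapping.lookup u0 (Tvar i j) < (q i + 1) * l i j"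
        using q_attained[OF i] by auto
      have "0 \<le> int (Poly_Mapping.lookup u (Tvar i j))" by simp
      also have "\<dots> < int ((q i + 1) * l i j) + y i * int (l i j)"
        unfolding yT[OF i j(1)] using j(2) by (intro add_strict_right_mono) (simp only: of_nat_less_iff)
      also have "\<dots> = (y i + int (q i) + 1) * int (l i j)"
        by (simp add: algebra_simps)
      finally have "y i + int (q i) + 1 > 0"
        using l_pos[OF i j(1)] by (simp add: zero_less_mult_iff)
      then show ?thesis by (simp add: z_def)
    qed
    have "Poly_Mapping.lookup u v = b v + (\<Sum>i=1..r. z i * block_exp l i v)" if v: "v \<in> V" for v
    proof (cases v)
      case (Svar k)
      then show ?thesis using y[OF v] sum_block_exp[of y v] sum_block_exp[of z v]
        by (simp add: b_def)
    next
      case (Tvar i j)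
      then have ij: "i \<in> {1..r}" "j \<in> {1..ns i}" using v by (auto simp: tvars_def)
      have "int (Poly_Mapping.lookup u v) = int (b v) + int (z i) * int (l i j)"
        using yT[OF ij] q_le[OF ij(2)]
        by (simp add: Tvar b_def z[OF ij(1)] of_nat_diff algebra_simps)
      then have "Poly_Mapping.lookup u v = b v + z i * l i j"
        by (metis of_nat_add of_nat_eq_iff of_nat_mult)
      then show ?thesis using sum_block_exp[of z v] ij Tvar by simp
    qed
    then have "mpol_monom V (Poly_Mapping.lookup u) =
        mpol_monom V (\<lambda>v. b v + (\<Sum>i=1..r. z i * block_exp l i v))"
      by (rule mpol_monom_cong)
    also have "\<dots> = mpol_monom V b * (\<Prod>i=1..r. T i ^ z i)"
      by (simp only: mpol_monom_add mpol_monom_blocks)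
    finally have "mpol_monom V (Poly_Mapping.lookup u) = mpol_monom V b * (\<Prod>i=1..r. T i ^ z i)" .
    then show ?thesis by blast
  qed
  then show ?thesis by blast
qed

text \<open>By \<open>cl_T\<close> each block is \<open>T 1\<close> plus a constant, so
  \<open>F\<close> can be taken as a product of powers of linear polynomials.\<close>

lemma cl_blocks:
  "\<exists>F. cl (\<Prod>i=1..r. T i ^ z i) = cl (poly (map_poly Const F) (T 1))"
proof -
  define F where "F = (\<Prod>i=1..r. [:a 1 - a i, 1:] ^ z i)"
  have car: "T 1 + Const c \<in> carrier P" for c
    using T_carrier[OF one_index] by (simp add: mpol_carrier_add)
  have "poly (map_poly Const F) (T 1) = (\<Prod>i=1..r. (Const (a 1 - a i) + T 1) ^ z i)"
    unfolding F_def map_poly_Const_prod map_poly_Const_power poly_prod poly_power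
    by (simp add: map_poly_Const_pCons Const_1)
  also have "\<dots> = (\<Prod>i=1..r. (T 1 + Const (a 1 - a i)) ^ z i)"
    by (simp only: add.commute)
  finally have "poly (map_poly Const F) (T 1) = (\<Prod>i=1..r. (T 1 + Const (a 1 - a i)) ^ z i)" .
  moreover have "cl (\<Prod>i=1..r. T i ^ z i) = cl (\<Prod>i=1..r. (T 1 + Const (a 1 - a i)) ^ z i)"
    using T_carrier car
    by (intro cl_prod_cong cl_power_cong mpol_carrier_power cl_T) auto
  ultimately have "cl (\<Prod>i=1..r. T i ^ z i) = cl (poly (map_poly Const F) (T 1))"
    by (simp only:)
  then show ?thesis by (rule exI)
qed

text \<open>All monomials of a homogeneous representative are one common monomial \<open>b\<close>
  times products of blocks. Modulo the ideal these products become polynomials in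
  \<open>T 1\<close>, which add up to \<open>F\<close>.\<close>

lemma homogeneous_imp_normal_form:
  assumes "K0_homogeneous r m ns l a h"
  shows "\<exists>F b. h = cl (poly (map_poly Const F) (T 1) * mpol_monom V b)"
proof -
  obtain w f where f: "f \<in> carrier P" "h = cl f"
    and w: "\<And>u. u \<in> Poly_Mapping.keys f \<Longrightarrow> monom_deg r m ns l u = w"
    using assms unfolding K0_homogeneous_def graded_part_def by auto
  have keys: "Poly_Mapping.keys u \<subseteq> V" if "u \<in> Poly_Mapping.keys f" for u
    using f(1) that by (auto simp: mpol_ring_carrier)
  note car = mpol_carrier_mult mpol_carrier_poly[OF T_carrier[OF one_index]] mpol_carrier_monom
  obtain b where b: "\<And>u. u \<in> Poly_Mapping.keys f \<Longrightarrow>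
      \<exists>z. mpol_monom V (Poly_Mapping.lookup u) = mpol_monom V b * (\<Prod>i=1..r. T i ^ z i)"
  \<comment> \<open>The zero polynomial has no monomial to start from, and then any \<open>b\<close>
    will do.\<close>
  proof (cases "f = 0")
    case False
    then obtain u0 where u0: "u0 \<in> Poly_Mapping.keys f"
      using keys_eq_empty by blast
    from least_monom_of_degree[OF keys[OF u0]] show ?thesis
      using w u0 keys that by (elim exE) blast
  qed (use that in auto)
  have single: "\<exists>F. cl (Poly_Mapping.single u (Poly_Mapping.lookup f u)) =
      cl (poly (map_poly Const F) (T 1) * mpol_monom V b)" if u: "u \<in> Poly_Mapping.keys f" for u
  proof -
    obtain z where z: "mpol_monom V (Poly_Mapping.lookup u) =
        mpol_monom V b * (\<Prod>i=1..r. T i ^ z i)"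
      using b[OF u] by blast
    obtain F where F: "cl (\<Prod>i=1..r. T i ^ z i) = cl (poly (map_poly Const F) (T 1))"
      using cl_blocks by blast
    have c: "(\<Prod>i=1..r. T i ^ z i) \<in> carrier P"
      by (intro mpol_carrier_prod mpol_carrier_power T_carrier)
    let ?c = "Poly_Mapping.lookup f u"
    have "cl (Poly_Mapping.single u ?c) =
        cl ((Const ?c * mpol_monom V b) * (\<Prod>i=1..r. T i ^ z i))"
      by (simp only: single_eq_mpol_monom[OF finite_tvars keys[OF u]] z mult.assoc)
    also have "\<dots> = cl ((Const ?c * mpol_monom V b) * poly (map_poly Const F) (T 1))"
      using c by (simp only: cl_mult car F mpol_carrier_Const)
    also have "(Const ?c * mpol_monom V b) * poly (map_poly Const F) (T 1) =
        poly (map_poly Const (Polynomial.smult ?c F)) (T 1) * mpol_monom V b"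
      by (simp add: map_poly_Const_smult mult_ac)
    finally show ?thesis by blast
  qed
  have "\<exists>F. cl (\<Sum>u\<in>U. Poly_Mapping.single u (Poly_Mapping.lookup f u)) =
      cl (poly (map_poly Const F) (T 1) * mpol_monom V b)" if "U \<subseteq> Poly_Mapping.keys f" for U
    using finite_subset[OF that finite_keys] that
  proof (induction U rule: finite_induct)
    case empty
    then show ?case by (intro exI[of _ 0]) simp
  next
    case (insert u U)
    let ?S = "\<lambda>u. Poly_Mapping.single u (Poly_Mapping.lookup f u)"
    obtain F where F: "cl (sum ?S U) = cl (poly (map_poly Const F) (T 1) * mpol_monom V b)"
      using insert by auto
    obtain G where G: "cl (?S u) = cl (poly (map_poly Const G) (T 1) * mpol_monom V b)"
      using single insert by blast
    have S: "?S u \<in> carrier P" if "u \<in> Poly_Mapping.keys f" for u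
      using keys[OF that] by (auto simp: mpol_ring_carrier)
    have "cl (sum ?S (insert u U)) = cl (?S u) \<oplus>\<^bsub>R\<^esub> cl (sum ?S U)"
      using insert S by (simp add: cl_add mpol_carrier_sum subset_iff)
    also have "\<dots> = cl (poly (map_poly Const G) (T 1) * mpol_monom V b
        + poly (map_poly Const F) (T 1) * mpol_monom V b)"
      unfolding F G by (rule cl_add[symmetric]; intro car)
    also have "poly (map_poly Const G) (T 1) * mpol_monom V b
        + poly (map_poly Const F) (T 1) * mpol_monom V b =
        poly (map_poly Const (G + F)) (T 1) * mpol_monom V b"
      by (simp add: map_poly_Const_add algebra_simps)
    finally show ?case by blast
  qed
  from this[OF subset_refl] show ?thesis
    unfolding f(2) mpol_expand[symmetric] by blast
qed

text \<open>Multiplication by \<open>T 1\<close> preserves degrees, so Horner's scheme for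
  \<open>F\<close> never leaves the set \<open>S\<close> of polynomials whose monomials all have
  degree \<open>w\<close>.\<close>

lemma normal_form_homogeneous:
  "K0_homogeneous r m ns l a (cl (poly (map_poly Const F) (T 1) * mpol_monom V b))"
proof -
  define e where "e c = (\<Sum>v\<in>V. Poly_Mapping.single v (c v))" for c :: "tvar \<Rightarrow> nat"
  define w where "w = monom_deg r m ns l (e b)"
  define S where "S = {f \<in> carrier P. \<forall>u\<in>Poly_Mapping.keys f. monom_deg r m ns l u = w}"
  have e: "Poly_Mapping.lookup (e c) v = (if v \<in> V then c v else 0)" for c v
    unfolding e_def by (rule lookup_sum_single[OF finite_tvars])
  have keys_e: "Poly_Mapping.keys (e c) \<subseteq> V" for c
    by (auto simp: in_keys_iff e split: if_splits)
  have monom: "mpol_monom V c = Poly_Mapping.single (e c) 1" for c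
    by (simp add: mpol_monom_eq_single e_def)
  have deg_shift: "monom_deg r m ns l (e (block_exp l 1) + u) = monom_deg r m ns l u"
    if u: "Poly_Mapping.keys u \<subseteq> V" for u
  proof (subst monom_deg_eq_iff)
    show "Poly_Mapping.keys (e (block_exp l 1) + u) \<subseteq> V"
      using keys_add[of "e (block_exp l 1)" u] keys_e u by blast
    \<comment> \<open>The unit vector at 1 picks out the first row of \<open>P0\<close>, which is
      what a factor \<open>T 1\<close> adds to an exponent vector.\<close>
    have "(\<Sum>i=1..r. (if i = 1 then 1 else 0) * int (block_exp l i v)) = int (block_exp l 1 v)" for v
      using one_index by (simp add: if_distrib[of "\<lambda>x. x * _"] cong: if_cong)
    then show "\<exists>y :: nat \<Rightarrow> int. \<forall>v\<in>V.
        int (Poly_Mapping.lookup (e (block_exp l 1) + u) v) =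
        int (Poly_Mapping.lookup u v) + (\<Sum>i=1..r. y i * int (block_exp l i v))"
      by (intro exI[of _ "\<lambda>i. if i = 1 then 1 else 0"]) (simp add: lookup_add e)
  qed fact
  have add: "f + g \<in> S" if "f \<in> S" "g \<in> S" for f g
    using that keys_add[of f g] by (auto simp: S_def mpol_carrier_add)
  have const: "Const c * mpol_monom V b \<in> S" for c
    by (auto simp: S_def w_def mpol_carrier_mult mpol_carrier_monom)
       (auto simp: monom Const_def mult_single split: if_splits)
  have shift: "T 1 * f \<in> S" if f: "f \<in> S" for f
    unfolding S_def
  proof (intro CollectI conjI ballI)
    show "T 1 * f \<in> carrier P"
      using f T_carrier[OF one_index] by (auto simp: S_def mpol_carrier_mult)
    fix u assume "u \<in> Poly_Mapping.keys (T 1 * f)"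
    moreover have "T 1 = Poly_Mapping.single (e (block_exp l 1)) 1"
      using T_eq_monom[OF one_index] monom by simp
    ultimately obtain u' where "u = e (block_exp l 1) + u'" "u' \<in> Poly_Mapping.keys f"
      using keys_mult[of "T 1" f] by auto
    then show "monom_deg r m ns l u = w"
      using f deg_shift by (auto simp: S_def mpol_ring_carrier)
  qed
  have "poly (map_poly Const F) (T 1) * mpol_monom V b \<in> S"
  proof (induction F)
    case 0
    show ?case using const[of 0] by (simp add: Const_0)
  next
    case (pCons c F)
    from add[OF const[of c] shift[OF this(2)]] show ?case
      by (simp add: map_poly_Const_pCons algebra_simps)
  qed
  moreover have "w \<in> carrier (K0 r m ns l)"
  proof -
    have "(\<Sum>v\<in>Poly_Mapping.keys (e b). frag_cmul (int (Poly_Mapping.lookup (e b) v)) (frag_of v))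
        \<in> carrier (free_Abelian_group V)"
      unfolding carrier_free_Abelian_group_iff
      using keys_e[of b] keys_sum[of _ "Poly_Mapping.keys (e b)"] by fastforce
    then show ?thesis
      unfolding w_def K0_def monom_deg_def Q_def FactGroup_def RCOSETS_def by auto
  qed
  ultimately show ?thesis
    unfolding K0_homogeneous_def graded_part_def S_def by blast
qed


section \<open>Kernels of the derivations\<close>

text \<open>Linearity and the Leibniz rule determine a derivation from its values on the variables;
  hence computations with \<open>\<delta>\<close> can be done with \<open>jac\<close> on
  representatives.\<close>

lemma derivation_cl:
  assumes \<delta>: "derivation_with_values r m ns l a g \<delta>"
    and g: "\<And>v. v \<in> V \<Longrightarrow> g v \<in> carrier P" and f: "f \<in> carrier P"
  shows "\<delta> (cl f) = cl (jac V g f)"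
proof -
  have closed: "\<delta> Z \<in> carrier R" if "Z \<in> carrier R" for Z
    using \<delta> that unfolding derivation_with_values_def derivation_on_def by blast
  have add: "\<delta> (Z \<oplus>\<^bsub>R\<^esub> Y) = \<delta> Z \<oplus>\<^bsub>R\<^esub> \<delta> Y" if "Z \<in> carrier R" "Y \<in> carrier R" for Z Y
    using \<delta> that unfolding derivation_with_values_def derivation_on_def by blast
  have mult: "\<delta> (Z \<otimes>\<^bsub>R\<^esub> Y) = (\<delta> Z \<otimes>\<^bsub>R\<^esub> Y) \<oplus>\<^bsub>R\<^esub> (Z \<otimes>\<^bsub>R\<^esub> \<delta> Y)"
    if "Z \<in> carrier R" "Y \<in> carrier R" for Z Y
    using \<delta> that unfolding derivation_with_values_def derivation_on_def by blast
  have scale: "\<delta> (cl (Const c) \<otimes>\<^bsub>R\<^esub> Z) = cl (Const c) \<otimes>\<^bsub>R\<^esub> \<delta> Z" if "Z \<in> carrier R" for c Z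
    using \<delta> that unfolding derivation_with_values_def derivation_on_def by blast
  have jac: "jac V g f \<in> carrier P" if "f \<in> carrier P" for f
    using that g by (rule mpol_carrier_jac)
  from finite_tvars f show ?thesis
  proof (induction f rule: mpol_induct)
    case (Const c)
    \<comment> \<open>The Leibniz rule for \<open>1 * 1\<close> forces the derivative of 1 to
      vanish, and linearity extends this to all constants.\<close>
    have "\<delta> \<one>\<^bsub>R\<^esub> = \<delta> \<one>\<^bsub>R\<^esub> \<oplus>\<^bsub>R\<^esub> \<delta> \<one>\<^bsub>R\<^esub>"
      using mult[of "\<one>\<^bsub>R\<^esub>" "\<one>\<^bsub>R\<^esub>"] closed[of "\<one>\<^bsub>R\<^esub>"] by simp
    then have "\<delta> \<one>\<^bsub>R\<^esub> = \<zero>\<^bsub>R\<^esub>"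
      using closed[of "\<one>\<^bsub>R\<^esub>"] cl.S.add.l_cancel_one' by auto
    then have "\<delta> (cl (Const c)) = \<zero>\<^bsub>R\<^esub>"
      using scale[of "\<one>\<^bsub>R\<^esub>" c] cl.hom_closed[of "Const c"] by simp
    then show ?case using cl.hom_zero by simp
  next
    case (Var v)
    then show ?case
      using \<delta> by (simp add: derivation_with_values_def jac_Var finite_tvars)
  next
    case (add f f')
    then show ?case
      by (simp add: jac_add cl_add \<open>\<And>Z Y. _ \<Longrightarrow> _ \<Longrightarrow> \<delta> (Z \<oplus>\<^bsub>R\<^esub> Y) = _\<close> jac)
  next
    case (mult f f')
    then show ?case
      by (simp add: jac_mult cl_add cl_mult mpol_carrier_mult jac
          \<open>\<And>Z Y. _ \<Longrightarrow> _ \<Longrightarrow> \<delta> (Z \<otimes>\<^bsub>R\<^esub> Y) = _\<close>)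
  qed
qed

lemma derivation_zero_iff:
  assumes "derivation_with_values r m ns l a g \<delta>"
    and "\<And>v. v \<in> V \<Longrightarrow> g v \<in> carrier P" and "f \<in> carrier P"
  shows "\<delta> (cl f) = \<zero>\<^bsub>R\<^esub> \<longleftrightarrow> jac V g f \<in> I"
  using assms mpol_carrier_jac[of f V g] by (simp add: derivation_cl cl_eq_zero_iff)

lemma normal_form_carrier: "poly (map_poly Const F) (T 1) * mpol_monom V b \<in> carrier P"
  by (intro mpol_carrier_mult mpol_carrier_poly mpol_carrier_monom T_carrier one_index)

section \<open>The kernel of the partial derivative with respect to \<open>Svar p\<close>\<close>

lemma mpol_monom_remove:
  "w \<in> V \<Longrightarrow> mpol_monom V b = mpol_monom V (b(w := 0)) * Var w ^ b w"
  unfolding mpol_monom_def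
  by (subst (1 2) prod.remove[of _ w]) (auto simp: finite_tvars mult.commute intro!: prod.cong)

text \<open>\<open>Svar p\<close> enters only through its own power. If its exponent is 0, the
  factor \<open>of_nat\<close> vanishes and the truncated exponent does no harm.\<close>

lemma partial_deriv_normal_form:
  assumes p: "p \<in> {1..m}"
  shows "partial_deriv (Svar p) (poly (map_poly Const F) (T 1) * mpol_monom V b) =
    of_nat (b (Svar p)) * Var (Svar p) ^ (b (Svar p) - 1)
      * (poly (map_poly Const F) (T 1) * mpol_monom V (b(Svar p := 0)))"
proof -
  have "Svar p \<in> V" using p by (auto simp: tvars_def)
  have T: "partial_deriv (Svar p) (T 1) = 0"
    by (rule partial_deriv_T_mono_0) simp
  have poly: "partial_deriv (Svar p) (poly (map_poly Const F) (T 1)) = 0"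
    by (induction F)
       (simp_all add: map_poly_Const_pCons partial_deriv_add partial_deriv_mult T del: One_nat_def)
  have monom: "partial_deriv (Svar p) (mpol_monom V (b(Svar p := 0))) = 0"
    unfolding mpol_monom_def
  proof (rule partial_deriv_prod_0)
    fix v
    show "partial_deriv (Svar p) (Var v ^ (b(Svar p := 0)) v) = 0"
      by (cases "v = Svar p") (auto intro!: partial_deriv_power_0 simp: partial_deriv_Var)
  qed
  have power: "partial_deriv (Svar p) (Var (Svar p) ^ n) = of_nat n * Var (Svar p) ^ (n - 1)" for n
    using jac_power[of V "\<lambda>w. if w = Svar p then 1 else 0" "Var (Svar p)" n] \<open>Svar p \<in> V\<close>
    by (simp add: jac_eq_partial_deriv finite_tvars partial_deriv_Var)
  show ?thesis
    by (subst mpol_monom_remove[OF \<open>Svar p \<in> V\<close>, of b])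
       (simp add: partial_deriv_mult poly monom power mult_ac del: One_nat_def)
qed

theorem partial_S_kernel:
  assumes p: "p \<in> {1..m}" and \<delta>: "is_partial_S r m ns l a p \<delta>"
  shows "(K0_homogeneous r m ns l a h \<and> \<delta> h = \<zero>\<^bsub>R\<^esub>) \<longleftrightarrow>
    (\<exists>F (b :: nat \<Rightarrow> nat \<Rightarrow> nat) d. h = cl (poly (map_poly Const F) (T 1)
        * (\<Prod>i=1..r. \<Prod>j=1..ns i. Var (Tvar i j) ^ b i j)
        * (\<Prod>k\<in>{1..m} - {p}. Var (Svar k) ^ d k)))"
proof -
  let ?g = "\<lambda>w. if w = Svar p then 1 else 0 :: 'k mpol"
  have "(\<lambda>v. case v of Tvar i j \<Rightarrow> 0 | Svar k \<Rightarrow> if k = p then 1 else 0) = ?g"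
    by (auto split: tvar.split)
  then have \<delta>': "derivation_with_values r m ns l a ?g \<delta>"
    using \<delta> by (simp add: is_partial_S_def)
  have pV: "Svar p \<in> V" using p by (auto simp: tvars_def)
  have kernel: "\<delta> (cl f) = \<zero>\<^bsub>R\<^esub> \<longleftrightarrow> partial_deriv (Svar p) f \<in> I" if "f \<in> carrier P" for f
    using derivation_zero_iff[OF \<delta>' _ that] by (simp add: jac_eq_partial_deriv finite_tvars pV)
  have prod_p: "(\<Prod>i=1..r. \<Prod>j=1..ns i. Var (Tvar i j) ^ b (Tvar i j))
      * (\<Prod>k\<in>{1..m} - {p}. Var (Svar k) ^ b (Svar k)) = (mpol_monom V b :: 'k mpol)"
    if "b (Svar p) = 0" for b
  proof -
    have "(\<Prod>k\<in>{1..m}. Var (Svar k) ^ b (Svar k)) =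
        (\<Prod>k\<in>{1..m} - {p}. Var (Svar k) ^ b (Svar k) :: 'k mpol)"
      using that by (intro prod.mono_neutral_right) auto
    then show ?thesis by (simp add: mpol_monom_V_eq)
  qed
  show ?thesis
  proof
    assume hom: "K0_homogeneous r m ns l a h \<and> \<delta> h = \<zero>\<^bsub>R\<^esub>"
    then obtain F b where Fb: "h = cl (poly (map_poly Const F) (T 1) * mpol_monom V b)"
      using homogeneous_imp_normal_form by blast
    let ?f = "poly (map_poly Const F) (T 1) * mpol_monom V b"
    have "\<exists>F b. b (Svar p) = 0 \<and> h = cl (poly (map_poly Const F) (T 1) * mpol_monom V b)"
    proof (cases "b (Svar p)")
      case (Suc n)
      have "partial_deriv (Svar p) ?f \<in> I"
        using hom Fb kernel normal_form_carrier by blast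
      \<comment> \<open>Multiplying the derivative by \<open>Svar p\<close> and dividing by the
        exponent \<open>Suc n\<close>, nonzero in characteristic zero, recovers
        \<open>?f\<close>.\<close>
      then have "Const (1 / of_nat (Suc n)) * (Var (Svar p) * partial_deriv (Svar p) ?f) \<in> I"
        using pV by (intro I_mult mpol_carrier_Const mpol_carrier_Var)
      moreover have "Var (Svar p) * partial_deriv (Svar p) ?f = Const (of_nat (Suc n)) * ?f"
      proof -
        have ofn: "of_nat k = (Const (of_nat k) :: 'k mpol)" for k
          by (induction k) (simp_all add: Const_add Const_0 Const_1)
        show ?thesis
          unfolding partial_deriv_normal_form[OF p] unfolding mpol_monom_remove[OF pV, of b] Suc ofn
          by (simp add: mult_ac del: of_nat_Suc)
      qed
      moreover have "Const (1 / of_nat (Suc n)) * (Const (of_nat (Suc n)) * ?f) = ?f"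
        by (simp add: Const_1 flip: mult.assoc Const_mult del: of_nat_Suc)
      ultimately have "?f \<in> I" by simp
      \<comment> \<open>A positive exponent of \<open>Svar p\<close> thus forces \<open>h\<close> to
        be 0, which is represented by \<open>F = 0\<close> and the monomial 1.\<close>
      then have "h = cl (poly (map_poly Const 0) (T 1) * mpol_monom V (\<lambda>_. 0))"
        using Fb cl_eq_iff[of ?f 0] normal_form_carrier by simp
      then show ?thesis by (intro exI[of _ 0] exI[of _ "\<lambda>_. 0"]) simp
    qed (use Fb in blast)
    then obtain F b where b0: "b (Svar p) = 0" and hFb: "h = cl (poly (map_poly Const F) (T 1) * mpol_monom V b)"
      by blast
    then show "\<exists>F (b :: nat \<Rightarrow> nat \<Rightarrow> nat) d. h = cl (poly (map_poly Const F) (T 1)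
        * (\<Prod>i=1..r. \<Prod>j=1..ns i. Var (Tvar i j) ^ b i j)
        * (\<Prod>k\<in>{1..m} - {p}. Var (Svar k) ^ d k))"
      by (intro exI[of _ F] exI[of _ "\<lambda>i j. b (Tvar i j)"] exI[of _ "\<lambda>k. b (Svar k)"])
        (simp only: hFb prod_p[of b, OF b0] mult.assoc)
  next
    assume "\<exists>F (b :: nat \<Rightarrow> nat \<Rightarrow> nat) d. h = cl (poly (map_poly Const F) (T 1)
        * (\<Prod>i=1..r. \<Prod>j=1..ns i. Var (Tvar i j) ^ b i j)
        * (\<Prod>k\<in>{1..m} - {p}. Var (Svar k) ^ d k))"
    then obtain F and b :: "nat \<Rightarrow> nat \<Rightarrow> nat" and d where
      Fbd: "h = cl (poly (map_poly Const F) (T 1)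
        * (\<Prod>i=1..r. \<Prod>j=1..ns i. Var (Tvar i j) ^ b i j)
        * (\<Prod>k\<in>{1..m} - {p}. Var (Svar k) ^ d k))"
      by (elim exE) (rule that)
    \<comment> \<open>The product leaves out \<open>k = p\<close>, so the exponent there may be set
      to 0.\<close>
    define c where "c = case_tvar b (d(p := 0))"
    have "(\<Prod>k\<in>{1..m} - {p}. Var (Svar k) ^ d k) =
        (\<Prod>k\<in>{1..m} - {p}. Var (Svar k) ^ c (Svar k) :: 'k mpol)"
      by (rule prod.cong) (auto simp: c_def)
    then have h': "h = cl (poly (map_poly Const F) (T 1) * mpol_monom V c)"
      using prod_p[of c] Fbd by (simp add: c_def mult.assoc)
    have "partial_deriv (Svar p) (poly (map_poly Const F) (T 1) * mpol_monom V c) = 0"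
      unfolding partial_deriv_normal_form[OF p] by (simp add: c_def)
    then have "\<delta> h = \<zero>\<^bsub>R\<^esub>"
      using kernel[OF normal_form_carrier] I_0 h' by simp
    then show "K0_homogeneous r m ns l a h \<and> \<delta> h = \<zero>\<^bsub>R\<^esub>"
      using h' normal_form_homogeneous by blast
  qed
qed

section \<open>Points of the variety\<close>

lemma ev_T: "i \<in> {1..r} \<Longrightarrow> ev V x (T i) = (\<Prod>j=1..ns i. x (Tvar i j) ^ l i j)"
  unfolding T_mono_def ev_prod ev_power
proof (rule prod.cong)
  fix j assume "i \<in> {1..r}" "j \<in> {1..ns i}"
  then have "Tvar i j \<in> V" by (auto simp: tvars_def)
  then show "ev V x (Var (Tvar i j)) ^ l i j = x (Tvar i j) ^ l i j"
    by (simp add: ev_Var finite_tvars)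
qed simp

text \<open>Over an algebraically closed field the first variable of each block can be a suitable
  root, with every other variable equal to 1.\<close>

lemma point_exists: "\<exists>x. (\<forall>i\<in>{1..r}. ev V x (T i) = s + a 1 - a i) \<and> (\<forall>k. x (Svar k) = 1)"
proof -
  have "\<exists>y. y ^ l i 1 = s + a 1 - a i" if "i \<in> {1..r}" for i
    using nth_root_exists[of "l i 1"] l_pos[OF that, of 1] ns_pos[OF that] by auto
  then obtain y where y: "\<And>i. i \<in> {1..r} \<Longrightarrow> y i ^ l i 1 = s + a 1 - a i" by metis
  define x where "x = case_tvar (\<lambda>i j. if j = 1 then y i else 1) (\<lambda>_. 1)"
  have "ev V x (T i) = s + a 1 - a i" if i: "i \<in> {1..r}" for i
  proof -
    have "ev V x (T i) = (\<Prod>j\<in>{1}. x (Tvar i j) ^ l i j)"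
      unfolding ev_T[OF i] using ns_pos[OF i]
      by (intro prod.mono_neutral_right) (auto simp: x_def)
    then show ?thesis using y[OF i] by (simp add: x_def)
  qed
  then show ?thesis by (intro exI[of _ x]) (simp add: x_def)
qed

text \<open>The polynomials vanishing at \<open>x\<close> form an ideal, which contains the
  generators because consecutive block values differ by the prescribed constant.\<close>

lemma ev_trinomial_ideal:
  assumes x: "\<And>i. i \<in> {1..r} \<Longrightarrow> ev V x (T i) = s + a 1 - a i" and f: "f \<in> I"
  shows "ev V x f = 0"
proof -
  let ?J = "{f \<in> carrier P. ev V x f = 0}"
  have "ideal ?J P"
  proof (rule idealI)
    show "ring P" by (rule P.ring_axioms)
    show "subgroup ?J (add_monoid P)"
    proof (rule group.subgroupI)
      show "Group.group (add_monoid P)" by (rule P.a_group)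
      show "?J \<subseteq> carrier (add_monoid P)" by auto
      show "?J \<noteq> {}" by (auto intro!: exI[of _ 0])
    next
      fix f assume f: "f \<in> ?J"
      then have "\<ominus>\<^bsub>P\<^esub> f = - f"
        by (intro P.minus_equality) (auto simp: mpol_carrier_uminus)
      then show "inv\<^bsub>add_monoid P\<^esub> f \<in> ?J"
        using f by (simp add: a_inv_def ev_uminus mpol_carrier_uminus)
    next
      fix f f' assume "f \<in> ?J" "f' \<in> ?J"
      then show "f \<otimes>\<^bsub>add_monoid P\<^esub> f' \<in> ?J"
        by (simp add: ev_add mpol_carrier_add)
    qed
  qed (auto simp: ev_mult mpol_carrier_mult)
  moreover have "trinomial ns l a ` {1..<r} \<subseteq> ?J"
  proof -
    have "trinomial ns l a i \<in> ?J" if i: "i \<in> {1..<r}" for i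
    proof -
      have "ev V x (T i) = s + a 1 - a i" "ev V x (T (i + 1)) = s + a 1 - a (i + 1)"
        using i x[of i] x[of "i + 1"] by auto
      then show ?thesis
        using mpol_carrier_trinomial[OF i] by (simp add: trinomial_def ev_diff)
    qed
    then show ?thesis by blast
  qed
  ultimately have "I \<subseteq> ?J"
    by (subst trinomial_ideal_def) (rule P.genideal_minimal)
  then show ?thesis using f by blast
qed

section \<open>The kernel of \<open>\<delta>\<close> for an admissible tuple\<close>

lemma delta_field_carrier: "delta_field r ns l C v \<in> carrier P"
  unfolding delta_field_def
  by (auto split: tvar.split
      intro!: mpol_carrier_prod mpol_carrier_partial_deriv mpol_carrier_T_mono)

text \<open>This is \<open>ev_jac_monom\<close> for a coordinate vector field, where only one term
  of the sum survives.\<close>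

lemma ev_partial_deriv_T:
  assumes i: "i \<in> {1..r}" and j: "j \<in> {1..ns i}" and x: "\<And>v. v \<in> V \<Longrightarrow> x v \<noteq> 0"
  shows "ev V x (partial_deriv (Tvar i j) (T i)) = ev V x (T i) * of_nat (l i j) / x (Tvar i j)"
proof -
  have ij: "Tvar i j \<in> V" using i j by (auto simp: tvars_def)
  have "ev V x (partial_deriv (Tvar i j) (T i)) = ev V x (T i) *
      (\<Sum>v\<in>V. of_nat (block_exp l i v) * ev V x (if v = Tvar i j then 1 else 0) / x v)"
    unfolding jac_eq_partial_deriv[OF finite_tvars ij, symmetric] T_eq_monom[OF i]
    by (rule ev_jac_monom) (use x finite_tvars in auto)
  also have "(\<Sum>v\<in>V. of_nat (block_exp l i v) * ev V x (if v = Tvar i j then 1 else 0) / x v) =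
      (\<Sum>v\<in>V. if v = Tvar i j then of_nat (l i j) / x (Tvar i j) else 0)"
    by (rule sum.cong) (auto simp: block_exp_def)
  finally show ?thesis using ij by (simp add: finite_tvars)
qed

text \<open>Where no variable vanishes, the logarithmic derivative of a monomial along \<open>\<delta>\<^sub>C\<close> is, up to the
  nowhere vanishing factor \<open>D = \<delta>\<^sub>C (T 1)\<close>, a sum of simple fractions in the value \<open>s\<close> of \<open>T 1\<close>.\<close>

lemma delta_kernel_exponents:
  assumes C: "\<And>i. i \<in> {1..r} \<Longrightarrow> C i \<in> {1..ns i}" and F: "F \<noteq> 0"
    and ker: "jac V (delta_field r ns l C) (poly (map_poly Const F) (T 1) * mpol_monom V b) \<in> I"
  shows "Polynomial.degree F = 0 \<and> (\<forall>i\<in>{1..r}. b (Tvar i (C i)) = 0)"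
proof (rule nonneg_quotients_sum_0)
  let ?g = "delta_field r ns l C :: tvar \<Rightarrow> 'k mpol"
  show "of_nat (Polynomial.degree F) +
      (\<Sum>i=1..r. of_nat (b (Tvar i (C i))) / of_nat (l i (C i))) = (0 :: 'k)"
  \<comment> \<open>The pole \<open>a i - a 1\<close> is the value of \<open>T 1\<close> at which
    \<open>T i\<close> vanishes; away from the poles all coordinates are nonzero.\<close>
  proof (rule log_derivative_identity[where e = "\<lambda>i. a i - a 1"])
    fix s assume s: "s \<notin> (\<lambda>i. a i - a 1) ` {1..r}"
    define \<tau> where "\<tau> i = s - (a i - a 1)" for i
    have \<tau>: "\<tau> i \<noteq> 0" if "i \<in> {1..r}" for i
      using s that by (auto simp: \<tau>_def)
    obtain x where x: "\<And>i. i \<in> {1..r} \<Longrightarrow> ev V x (T i) = s + a 1 - a i"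
        and xS: "\<And>k. x (Svar k) = 1"
      using point_exists by blast
    have xT: "ev V x (T i) = \<tau> i" if "i \<in> {1..r}" for i
      using x[OF that] by (simp add: \<tau>_def algebra_simps)
    have x_nz: "x v \<noteq> 0" if "v \<in> V" for v
    proof (cases v)
      case (Tvar i j)
      then have ij: "i \<in> {1..r}" "j \<in> {1..ns i}" using that by (auto simp: tvars_def)
      have "(\<Prod>j=1..ns i. x (Tvar i j) ^ l i j) \<noteq> 0"
        using xT[OF ij(1)] \<tau>[OF ij(1)] by (simp add: ev_T[OF ij(1)])
      then have "x (Tvar i j) ^ l i j \<noteq> 0"
        using ij(2) by (simp add: prod_zero_iff)
      then show ?thesis using l_pos[OF ij] by (auto simp: Tvar power_0_left)
    qed (simp add: xS)
    define w where "w i = Tvar i (C i)" for i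
    have wV: "w i \<in> V" if "i \<in> {1..r}" for i
      using C that by (auto simp: w_def tvars_def)
    \<comment> \<open>\<open>d i\<close> is the value of the partial derivative of
      \<open>T i\<close> by \<open>w i\<close>, so the field has the value \<open>D / d i\<close> at
      \<open>w i\<close>.\<close>
    define d where "d i = \<tau> i * of_nat (l i (C i)) / x (w i)" for i
    have d_nz: "d i \<noteq> 0" if "i \<in> {1..r}" for i
      using \<tau>[OF that] l_pos[OF that C[OF that]] x_nz[OF wV[OF that]] by (simp add: d_def)
    define D where "D = (\<Prod>i=1..r. d i)"
    have D: "D \<noteq> 0" using d_nz by (simp add: D_def)
    have gw: "ev V x (?g (w i)) = D / d i" if i: "i \<in> {1..r}" for i
    proof -
      have "ev V x (partial_deriv (Tvar k (C k)) (T k)) = d k" if "k \<in> {1..r}" for k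
        by (subst ev_partial_deriv_T[OF that C[OF that] x_nz])
           (simp_all only: xT[OF that] d_def w_def)
      then have "ev V x (?g (w i)) = (\<Prod>k\<in>{1..r} - {i}. d k)"
        by (simp add: delta_field_def w_def ev_prod)
      also have "\<dots> = D / d i"
      proof -
        have "D = d i * (\<Prod>k\<in>{1..r} - {i}. d k)"
          unfolding D_def using i by (intro prod.remove) auto
        then show ?thesis using d_nz[OF i] by simp
      qed
      finally show ?thesis .
    qed
    have g0: "?g v = 0" if "v \<in> V" "v \<notin> w ` {1..r}" for v
      using that by (auto simp: delta_field_def w_def tvars_def)
    \<comment> \<open>Only the \<open>w i\<close> contribute, and
      \<open>d i * x (w i) = \<tau> i * of_nat (l i (C i))\<close> produces the simple
      fractions.\<close>
    have sum: "(\<Sum>v\<in>V. of_nat (c v) * ev V x (?g v) / x v) =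
        D * (\<Sum>i=1..r. of_nat (c (w i)) / of_nat (l i (C i)) / \<tau> i)" for c
    proof -
      have "(\<Sum>v\<in>V. of_nat (c v) * ev V x (?g v) / x v) =
          (\<Sum>v\<in>w ` {1..r}. of_nat (c v) * ev V x (?g v) / x v)"
      proof (intro sum.mono_neutral_right ballI)
        fix v assume "v \<in> V - w ` {1..r}"
        then have "?g v = 0" by (intro g0) auto
        then show "of_nat (c v) * ev V x (?g v) / x v = 0" by simp
      next
        show "w ` {1..r} \<subseteq> V" using wV by blast
      qed (rule finite_tvars)
      also have "\<dots> = (\<Sum>i=1..r. of_nat (c (w i)) * ev V x (?g (w i)) / x (w i))"
        by (subst sum.reindex) (auto simp: inj_on_def w_def)
      also have "\<dots> = (\<Sum>i=1..r. D * (of_nat (c (w i)) / of_nat (l i (C i)) / \<tau> i))"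
        using \<tau> wV x_nz by (intro sum.cong) (auto simp: gw d_def mult_ac)
      finally show ?thesis by (simp add: sum_distrib_left)
    qed
    have jacT: "ev V x (jac V ?g (T 1)) = D"
    proof -
      \<comment> \<open>Among the \<open>w i\<close> only \<open>w 1\<close> occurs in
        \<open>T 1\<close>, and its exponent cancels the denominator.\<close>
      have "(\<Sum>i=1..r. of_nat (block_exp l 1 (w i)) / of_nat (l i (C i)) / \<tau> i) =
          (\<Sum>i=1..r. if i = 1 then 1 / \<tau> 1 else 0)"
        using l_pos[OF one_index C[OF one_index]]
        by (intro sum.cong) (auto simp: block_exp_def w_def)
      also have "\<dots> = 1 / \<tau> 1"
        using one_index by simp
      finally have S: "(\<Sum>i=1..r. of_nat (block_exp l 1 (w i)) / of_nat (l i (C i)) / \<tau> i) = 1 / \<tau> 1" .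
      have "ev V x (jac V ?g (T 1)) = ev V x (T 1) *
          (\<Sum>v\<in>V. of_nat (block_exp l 1 v) * ev V x (?g v) / x v)"
        unfolding T_eq_monom[OF one_index] by (rule ev_jac_monom[OF finite_tvars x_nz])
      also have "\<dots> = \<tau> 1 * (D * (1 / \<tau> 1))"
        by (simp only: sum S xT[OF one_index])
      finally show ?thesis using \<tau>[OF one_index] by simp
    qed
    define M where "M = ev V x (mpol_monom V b)"
    have M: "M \<noteq> 0"
      using x_nz by (auto simp: M_def mpol_monom_def ev_prod ev_power ev_Var finite_tvars)
    define S where "S = (\<Sum>i=1..r. of_nat (b (w i)) / of_nat (l i (C i)) / \<tau> i)"
    have jacM: "ev V x (jac V ?g (mpol_monom V b)) = M * (D * S)"
      unfolding M_def S_def sum[symmetric] by (rule ev_jac_monom[OF finite_tvars x_nz])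
    have \<tau>1: "\<tau> 1 = s" by (simp add: \<tau>_def)
    \<comment> \<open>The product rule, divided by the nonzero \<open>D * M\<close>, leaves the
      differential identity in \<open>s\<close>.\<close>
    have "0 = ev V x (jac V ?g (poly (map_poly Const F) (T 1) * mpol_monom V b))"
      using ev_trinomial_ideal[OF x ker] by simp
    also have "\<dots> = poly (pderiv F) s * D * M + poly F s * (M * (D * S))"
      by (simp only: jac_mult ev_add ev_mult ev_jac_poly ev_poly jacT jacM xT[OF one_index] \<tau>1
          M_def[symmetric])
    also have "\<dots> = D * M * (poly (pderiv F) s + poly F s * S)"
      by (simp only: distrib_left mult_ac)
    finally show "poly (pderiv F) s + poly F s *
        (\<Sum>i=1..r. of_nat (b (Tvar i (C i))) / of_nat (l i (C i)) / (s - (a i - a 1))) = 0"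
      using D M by (simp add: S_def w_def \<tau>_def)
  qed (use F in auto)
qed (use l_pos C in auto)

text \<open>By the Leibniz rule each term contains some \<open>g v\<close> with
  \<open>b v \<noteq> 0\<close>. This shows that monomials in variables killed by
  \<open>\<delta>\<close> are killed.\<close>

lemma jac_monom_in_ideal:
  assumes "\<And>v. v \<in> V \<Longrightarrow> b v \<noteq> 0 \<Longrightarrow> g v \<in> I"
  shows "jac V g (mpol_monom V b) \<in> I"
proof -
  have "jac V g (\<Prod>v\<in>W. Var v ^ b v) \<in> I" if "W \<subseteq> V" for W
    using finite_subset[OF that finite_tvars] that
  proof (induction W rule: finite_induct)
    case empty
    show ?case by (simp add: I_0)
  next
    case (insert v W)
    have car: "Var v ^ k \<in> carrier P" "(\<Prod>v\<in>W. Var v ^ b v) \<in> carrier P" for k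
      using insert by (auto intro!: mpol_carrier_prod mpol_carrier_power mpol_carrier_Var)
    have ofn: "of_nat k \<in> carrier P" for k
      by (induction k) (simp_all add: mpol_carrier_add)
    have "jac V g (Var v ^ b v) \<in> I"
    proof (cases "b v")
      case 0
      then show ?thesis by (simp add: I_0)
    next
      case (Suc n)
      then have "g v \<in> I" using assms insert by auto
      then show ?thesis
        using insert by (auto simp: jac_power jac_Var finite_tvars intro!: I_mult mpol_carrier_mult ofn car)
    qed
    then have "(\<Prod>v\<in>W. Var v ^ b v) * jac V g (Var v ^ b v) \<in> I"
      by (rule I_mult) (rule car)
    moreover have "Var v ^ b v * jac V g (\<Prod>v\<in>W. Var v ^ b v) \<in> I"
      using insert by (intro I_mult car) auto
    ultimately show ?case
      using insert I_add by (simp add: jac_mult mult.commute)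
  qed
  from this[of V] show ?thesis by (simp add: mpol_monom_def)
qed

theorem delta_kernel:
  assumes C: "admissible_tuple r ns l C" and \<delta>: "is_delta r m ns l a C \<delta>"
  shows "(K0_homogeneous r m ns l a h \<and> \<delta> h = \<zero>\<^bsub>R\<^esub>) \<longleftrightarrow>
    (\<exists>\<alpha> (b :: nat \<Rightarrow> nat \<Rightarrow> nat) d. h = cl (Const \<alpha>
        * (\<Prod>(i, j)\<in>{(i, j). i \<in> {1..r} \<and> j \<in> {1..ns i} \<and>
              \<delta> (cl (Var (Tvar i j))) = \<zero>\<^bsub>R\<^esub>}. Var (Tvar i j) ^ b i j)
        * (\<Prod>k=1..m. Var (Svar k) ^ d k)))"
    (is "_ \<longleftrightarrow> (\<exists>\<alpha> b d. h = cl (Const \<alpha> * (\<Prod>(i, j)\<in>?Z. Var (Tvar i j) ^ b i j) * ?S d))")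
proof -
  let ?g = "delta_field r ns l C :: tvar \<Rightarrow> 'k mpol"
  have Ci: "C i \<in> {1..ns i}" if "i \<in> {1..r}" for i
    using C that by (simp add: admissible_tuple_def)
  have \<delta>': "derivation_with_values r m ns l a ?g \<delta>"
    using \<delta> by (simp add: is_delta_def delta_field_def[abs_def])
  have \<delta>_Var: "\<delta> (cl (Var v)) = cl (?g v)" if "v \<in> V" for v
    using \<delta>' that by (simp add: derivation_with_values_def)
  note kernel = derivation_zero_iff[OF \<delta>' delta_field_carrier]
  \<comment> \<open>Factors outside \<open>?Z\<close> have exponent 0 and may be added, giving a
    monomial over all of \<open>V\<close>.\<close>
  have prod_Z: "(\<Prod>(i, j)\<in>?Z. Var (Tvar i j) ^ b (Tvar i j)) * ?S (\<lambda>k. b (Svar k)) =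
      (mpol_monom V b :: 'k mpol)"
    if "\<And>i j. i \<in> {1..r} \<Longrightarrow> j \<in> {1..ns i} \<Longrightarrow> (i, j) \<notin> ?Z \<Longrightarrow> b (Tvar i j) = 0" for b
  proof -
    let ?A = "SIGMA i:{1..r}. {1..ns i}"
    have "(\<Prod>i=1..r. \<Prod>j=1..ns i. Var (Tvar i j) ^ b (Tvar i j)) =
        (\<Prod>(i, j)\<in>?A. Var (Tvar i j) ^ b (Tvar i j) :: 'k mpol)"
      by (rule prod.Sigma) auto
    also have "\<dots> = (\<Prod>(i, j)\<in>?Z. Var (Tvar i j) ^ b (Tvar i j))"
    proof (intro prod.mono_neutral_right ballI)
      fix q assume q: "q \<in> ?A - ?Z"
      obtain i j where ij: "q = (i, j)" by (cases q)
      then have "b (Tvar i j) = 0" using q by (intro that) blast+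
      then show "(case q of (i, j) \<Rightarrow> Var (Tvar i j) ^ b (Tvar i j)) = (1 :: 'k mpol)"
        by (simp add: ij)
    next
      show "?Z \<subseteq> ?A" by blast
    qed simp
    finally show ?thesis by (simp add: mpol_monom_V_eq)
  qed
  show ?thesis
  proof
    assume hom: "K0_homogeneous r m ns l a h \<and> \<delta> h = \<zero>\<^bsub>R\<^esub>"
    then obtain F b where Fb: "h = cl (poly (map_poly Const F) (T 1) * mpol_monom V b)"
      using homogeneous_imp_normal_form by blast
    have "\<exists>\<alpha> b. (\<forall>i\<in>{1..r}. b (Tvar i (C i)) = 0) \<and> h = cl (Const \<alpha> * mpol_monom V b)"
    proof (cases "F = 0")
      \<comment> \<open>The zero element is covered by \<open>\<alpha> = 0\<close>.\<close>
      case True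
      then show ?thesis
        using Fb by (intro exI[of _ 0] exI[of _ "\<lambda>_. 0"]) (simp add: Const_0)
    next
      case False
      have "jac V ?g (poly (map_poly Const F) (T 1) * mpol_monom V b) \<in> I"
        using hom Fb kernel[OF normal_form_carrier] by simp
      from delta_kernel_exponents[OF Ci False this]
      have degF: "Polynomial.degree F = 0" and b: "\<forall>i\<in>{1..r}. b (Tvar i (C i)) = 0"
        by auto
      from degF obtain \<alpha> where "F = [:\<alpha>:]" by (rule degree_eq_zeroE)
      then show ?thesis
        using Fb b by (intro exI[of _ \<alpha>] exI[of _ b]) (simp add: map_poly_Const_pCons)
    qed
    then obtain \<alpha> b where b: "\<And>i. i \<in> {1..r} \<Longrightarrow> b (Tvar i (C i)) = 0"
      and h': "h = cl (Const \<alpha> * mpol_monom V b)"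
      by blast
    \<comment> \<open>The field is 0 on \<open>Tvar i j\<close> unless \<open>j = C i\<close>, so a
      pair outside \<open>?Z\<close> is \<open>(i, C i)\<close>, where the exponent is already known
      to vanish.\<close>
    have bZ: "b (Tvar i j) = 0" if ij: "i \<in> {1..r}" "j \<in> {1..ns i}" "(i, j) \<notin> ?Z" for i j
    proof -
      have "Tvar i j \<in> V" using ij by (auto simp: tvars_def)
      then have "cl (?g (Tvar i j)) \<noteq> \<zero>\<^bsub>R\<^esub>" using ij \<delta>_Var by auto
      then have "j = C i" using cl.hom_zero by (auto simp: delta_field_def split: if_splits)
      then show ?thesis using b ij by simp
    qed
    have "(\<Prod>(i, j)\<in>?Z. Var (Tvar i j) ^ b (Tvar i j)) * ?S (\<lambda>k. b (Svar k)) =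
        (mpol_monom V b :: 'k mpol)"
      by (rule prod_Z) (rule bZ)
    then show "\<exists>\<alpha> b d. h = cl (Const \<alpha>
        * (\<Prod>(i, j)\<in>?Z. Var (Tvar i j) ^ b i j) * ?S d)"
      using h' by (intro exI[of _ \<alpha>] exI[of _ "\<lambda>i j. b (Tvar i j)"] exI[of _ "\<lambda>k. b (Svar k)"])
        (simp only: mult.assoc)
  next
    assume "\<exists>\<alpha> b d. h = cl (Const \<alpha> * (\<Prod>(i, j)\<in>?Z. Var (Tvar i j) ^ b i j) * ?S d)"
    then obtain \<alpha> b d where h': "h = cl (Const \<alpha>
        * (\<Prod>(i, j)\<in>?Z. Var (Tvar i j) ^ b i j) * ?S d)"
      by (elim exE) (rule that)
    define c where "c = case_tvar (\<lambda>i j. if (i, j) \<in> ?Z then b i j else 0) d"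
    have b_eq: "(\<Prod>(i, j)\<in>?Z. Var (Tvar i j) ^ b i j) =
        (\<Prod>(i, j)\<in>?Z. Var (Tvar i j) ^ c (Tvar i j) :: 'k mpol)"
      by (rule prod.cong) (auto simp: c_def)
    have d_eq: "?S d = (?S (\<lambda>k. c (Svar k)) :: 'k mpol)"
      by (simp add: c_def)
    have cZ: "c (Tvar i j) = 0" if "(i, j) \<notin> ?Z" for i j
      using that by (simp only: c_def tvar.case if_False)
    have "(\<Prod>(i, j)\<in>?Z. Var (Tvar i j) ^ c (Tvar i j)) * ?S (\<lambda>k. c (Svar k)) =
        (mpol_monom V c :: 'k mpol)"
      by (rule prod_Z) (rule cZ)
    then have hc: "h = cl (Const \<alpha> * mpol_monom V c)"
      unfolding h' b_eq d_eq by (simp only: mult.assoc)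
    have "jac V ?g (mpol_monom V c) \<in> I"
    proof (rule jac_monom_in_ideal)
      \<comment> \<open>For a \<open>Tvar\<close> the nonzero exponent means membership in
        \<open>?Z\<close>, hence a value of the field in the ideal; on each \<open>Svar\<close> the
        field is 0.\<close>
      fix v assume v: "v \<in> V" "c v \<noteq> 0"
      show "?g v \<in> I"
      proof (cases v)
        case (Tvar i j)
        then have "\<delta> (cl (Var v)) = \<zero>\<^bsub>R\<^esub>"
          using v by (auto simp: c_def split: if_splits)
        then show ?thesis
          using \<delta>_Var[OF v(1)] cl_eq_zero_iff[OF delta_field_carrier] by simp
      qed (simp add: delta_field_def I_0)
    qed
    then have "jac V ?g (Const \<alpha> * mpol_monom V c) \<in> I"
      by (simp add: jac_mult I_mult)
    then have "\<delta> h = \<zero>\<^bsub>R\<^esub>"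
      using kernel[of "Const \<alpha> * mpol_monom V c"] hc
      by (simp add: mpol_carrier_mult mpol_carrier_monom)
    moreover have "K0_homogeneous r m ns l a h"
      using normal_form_homogeneous[of "[:\<alpha>:]" c] hc by (simp add: map_poly_Const_pCons)
    ultimately show "K0_homogeneous r m ns l a h \<and> \<delta> h = \<zero>\<^bsub>R\<^esub>" by blast
  qed
qed

end

theorem proposition4:
  fixes r n m :: nat and ns :: "nat \<Rightarrow> nat" and l :: "nat \<Rightarrow> nat \<Rightarrow> nat"
    and a :: "nat \<Rightarrow> 'k::{alg_closed_field, field_char_0}"
  assumes "r > 0" and "n > 0"
    and "n = (\<Sum>i=1..r. ns i)"
    and "\<And>i. i \<in> {1..r} \<Longrightarrow> ns i > 0"
    and "\<And>i j. i \<in> {1..r} \<Longrightarrow> j \<in> {1..ns i} \<Longrightarrow> l i j > 0"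
    and "inj_on a {1..r}"
  shows "(\<forall>p\<in>{1..m}. \<forall>\<delta>. is_partial_S r m ns l a p \<delta> \<longrightarrow>
      (\<forall>h\<in>carrier (trinomial_algebra r m ns l a).
        (K0_homogeneous r m ns l a h \<and> \<delta> h = \<zero>\<^bsub>trinomial_algebra r m ns l a\<^esub>) \<longleftrightarrow>
        (\<exists>(F :: 'k poly) (b :: nat \<Rightarrow> nat \<Rightarrow> nat) (d :: nat \<Rightarrow> nat).
          h = residue_cl r m ns l a
            (poly (map_poly Const F) (T_mono ns l 1)
              * (\<Prod>i=1..r. \<Prod>j=1..ns i. Var (Tvar i j) ^ b i j)
              * (\<Prod>k\<in>{1..m} - {p}. Var (Svar k) ^ d k))))) \<and>
    (\<forall>C \<delta>. admissible_tuple r ns l C \<and> is_delta r m ns l a C \<delta> \<longrightarrow>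
      (\<forall>h\<in>carrier (trinomial_algebra r m ns l a).
        (K0_homogeneous r m ns l a h \<and> \<delta> h = \<zero>\<^bsub>trinomial_algebra r m ns l a\<^esub>) \<longleftrightarrow>
        (\<exists>(\<alpha> :: 'k) (b :: nat \<Rightarrow> nat \<Rightarrow> nat) (d :: nat \<Rightarrow> nat).
          h = residue_cl r m ns l a
            (Const \<alpha>
              * (\<Prod>(i, j)\<in>{(i, j). i \<in> {1..r} \<and> j \<in> {1..ns i} \<and>
                    \<delta> (residue_cl r m ns l a (Var (Tvar i j))) = \<zero>\<^bsub>trinomial_algebra r m ns l a\<^esub>}.
                  Var (Tvar i j) ^ b i j)
              * (\<Prod>k=1..m. Var (Svar k) ^ d k)))))"
proof -
  interpret trinomial_data r m ns l a
    using assms by unfold_locales auto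
  show ?thesis
    by (intro conjI ballI allI impI; (elim conjE)?; rule partial_S_kernel delta_kernel; assumption)
qed

end
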